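(* Let $\mathbb{G}$ be a compact quantum group, $\Phi$ an idempotent state on $\mathscr{O}(\mathbb{G})$, and $\delta=\varepsilon|_{\mathscr{O}_{\mathbb{G}}(\Phi\backslash\mathbb{G})}$. There are one-to-one correspondences between the following objects: (1) semigroups $(T_t)_{t\ge0}$ of $\mathbb{G}$-invariant operators on $\mathscr{O}_{\mathbb{G}}(\Phi\backslash\mathbb{G})$ such that $(\delta\circ T_t)_{t\ge0}$ is weakly continuous; (2) convolution semigroups $(\lambda_t)_{t\ge0}$ of $\Phi$-invariant linear functionals on $\mathscr{O}_{\mathbb{G}}(\Phi\backslash\mathbb{G})$; (3) convolution semigroups $(\mu_t)_{t\ge0}$ of $\Phi$-bi-invariant linear functionals on $\mathscr{O}(\mathbb{G})$; (4) convolution semigroups $(f_t)_{t\ge0}$ of linear functionals on $\mathscr{O}_{\mathbb{G}}(\Phi\backslash\mathbb{G}/\Phi)$. The correspondences are given by $\lambda_t=\delta\circ T_t$, $T_t=(\lambda_t\otimes\mathbb{E}_\ell)\circ\alpha$; $\mu_t=\lambda_t\circ\mathbb{E}_\ell$, $\lambda_t=\mu_t|_{\mathscr{O}_{\mathbb{G}}(\Phi\backslash\mathbb{G})}$; and $f_t=\mu_t|_{\mathscr{O}_{\mathbb{G}}(\Phi\backslash\mathbb{G}/\Phi)}$, $\mu_t=f_t\circ\mathbb{E}_\ell\circ\mathbb{E}_r$.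
   Context: $\mathscr{O}(\mathbb{G})$ is the canonical dense Hopf $*$-algebra of $\mathbb{G}$, with coproduct $\Delta$ and counit $\varepsilon$. Convolution of linear functionals on $\mathscr{O}(\mathbb{G})$: $\mu\star\nu=(\mu\otimes\nu)\circ\Delta$. An idempotent state is a linear functional $\Phi$ with $\Phi(1)=1$, $\Phi(a^*a)\ge0$ and $\Phi\star\Phi=\Phi$. Put $\mathbb{E}_\ell=(\Phi\otimes\mathrm{id})\circ\Delta$, $\mathbb{E}_r=(\mathrm{id}\otimes\Phi)\circ\Delta$ on $\mathscr{O}(\mathbb{G})$; these are commuting idempotents (conditional expectations). Let $\mathscr{O}_{\mathbb{G}}(\Phi\backslash\mathbb{G})=\mathbb{E}_\ell(\mathscr{O}(\mathbb{G}))$, $\mathscr{O}_{\mathbb{G}}(\mathbb{G}/\Phi)=\mathbb{E}_r(\mathscr{O}(\mathbb{G}))$, $\mathscr{O}_{\mathbb{G}}(\Phi\backslash\mathbb{G}/\Phi)=\mathscr{O}_{\mathbb{G}}(\Phi\backslash\mathbb{G})\cap\mathscr{O}_{\mathbb{G}}(\mathbb{G}/\Phi)=\mathbb{E}_\ell(\mathbb{E}_r(\mathscr{O}(\mathbb{G})))$; these are unital $*$-subalgebras, and $\alpha:=\Delta|_{\mathscr{O}_{\mathbb{G}}(\Phi\backslash\mathbb{G})}$ maps into $\mathscr{O}_{\mathbb{G}}(\Phi\backslash\mathbb{G})\otimes\mathscr{O}(\mathbb{G})$. A functional $f$ on $\mathscr{O}_{\mathbb{G}}(\Phi\backslash\mathbb{G})$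 is $\Phi$-invariant if $(f\otimes\Phi)\circ\alpha=f$. A functional $\mu$ on $\mathscr{O}(\mathbb{G})$ is $\Phi$-bi-invariant if $\Phi\star\mu=\mu=\mu\star\Phi$. A linear map $T$ on $\mathscr{O}_{\mathbb{G}}(\Phi\backslash\mathbb{G})$ is $\mathbb{G}$-invariant if $(T\otimes\mathrm{id})\circ\alpha=\alpha\circ T$. Convolutions: on $\mathscr{O}_{\mathbb{G}}(\Phi\backslash\mathbb{G})$, $f\star_\ell g=(f\otimes(g\circ\mathbb{E}_\ell))\circ\alpha$; on $\mathscr{O}_{\mathbb{G}}(\Phi\backslash\mathbb{G}/\Phi)$, $f\star_{bi}g=(f\otimes g)\circ\widetilde\Delta$, where $\widetilde\Delta(x)=(\mathrm{id}\otimes\Phi\otimes\mathrm{id})\big((\mathrm{id}\otimes\Delta)\Delta(x)\big)$, which lies in $\mathscr{O}_{\mathbb{G}}(\Phi\backslash\mathbb{G}/\Phi)\otimes\mathscr{O}_{\mathbb{G}}(\Phi\backslash\mathbb{G}/\Phi)$ for $x\in\mathscr{O}_{\mathbb{G}}(\Phi\backslash\mathbb{G}/\Phi)$. A family $(f_t)_{t\ge0}$ of linear functionals is weakly continuous if $\lim_{t\searrow0}f_t(a)=f_0(a)$ for all $a$. A convolution semigroup (of linear functionals) on any of the three algebras is a weakly continuous family $(f_t)_{t\ge0}$ whose convolution products (with the respective convolution) satisfy $f_s\star f_t=f_{s+t}$ for all $s,t\ge0$. A semigroup of operators is a family $(T_t)_{t\ge0}$ with $T_{s+t}=T_s\circ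 T_t$ for all $s,t\ge0$ ($T_0$ need not be the identity). *)

theory Defs
  imports Complex_Main "HOL-Library.FuncSet" "HOL-Library.Poly_Mapping"
begin

section \<open>Complex vector spaces and algebras\<close>

class complex_vector = ab_group_add +
  fixes scaleC :: "complex \<Rightarrow> 'a \<Rightarrow> 'a"  (infixr \<open>*\<^sub>C\<close> 75)
  assumes scaleC_add_right: "c *\<^sub>C (x + y) = c *\<^sub>C x + c *\<^sub>C y"
    and scaleC_add_left: "(c + d) *\<^sub>C x = c *\<^sub>C x + d *\<^sub>C x"
    and scaleC_scaleC: "c *\<^sub>C (d *\<^sub>C x) = (c * d) *\<^sub>C x"
    and scaleC_one: "1 *\<^sub>C x = x"

global_interpretation complex_vector: vector_space "scaleC :: complex \<Rightarrow> 'a \<Rightarrow> 'a::complex_vector"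
  by unfold_locales
    (simp_all add: scaleC_add_right scaleC_add_left scaleC_scaleC scaleC_one)

class complex_algebra_1 = complex_vector + ring_1 +
  assumes mult_scaleC_left: "(c *\<^sub>C x) * y = c *\<^sub>C (x * y)"
    and mult_scaleC_right: "x * (c *\<^sub>C y) = c *\<^sub>C (x * y)"

instantiation complex :: complex_algebra_1
begin

definition scaleC_complex :: "complex \<Rightarrow> complex \<Rightarrow> complex"
  where "scaleC_complex c x = c * x"

instance
  by standard (simp_all add: scaleC_complex_def algebra_simps)

end

definition clinear_on :: "'a set \<Rightarrow> ('a::complex_vector \<Rightarrow> 'b::complex_vector) \<Rightarrow> bool"
  where "clinear_on V f \<longleftrightarrow>
    (\<forall>x\<in>V. \<forall>y\<in>V. f (x + y) = f x + f y) \<and> (\<forall>c. \<forall>x\<in>V. f (c *\<^sub>C x) = c *\<^sub>C f x)"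

abbreviation clinear :: "('a::complex_vector \<Rightarrow> 'b::complex_vector) \<Rightarrow> bool"
  where "clinear \<equiv> clinear_on UNIV"


section \<open>The algebraic tensor product\<close>

text \<open>
  The tensor product is the free complex vector space on pairs, modulo the subspace
  spanned by the bilinearity relators.
\<close>

definition free_scale :: "complex \<Rightarrow> ('k \<Rightarrow>\<^sub>0 complex) \<Rightarrow> 'k \<Rightarrow>\<^sub>0 complex"
  where "free_scale c p = Poly_Mapping.map ((*) c) p"

lemma lookup_free_scale [simp]: "Poly_Mapping.lookup (free_scale c p) k = c * Poly_Mapping.lookup p k"
  unfolding free_scale_def by transfer (simp add: when_def)

global_interpretation free_cvec: vector_space "free_scale :: complex \<Rightarrow> ('k \<Rightarrow>\<^sub>0 complex) \<Rightarrow> _"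
  by unfold_locales
    (auto intro!: poly_mapping_eqI simp: Poly_Mapping.lookup_add algebra_simps)

definition tensor_relators :: "('a::complex_vector \<times> 'b::complex_vector \<Rightarrow>\<^sub>0 complex) set"
  where "tensor_relators =
    {Poly_Mapping.single (a + a', b) 1 - Poly_Mapping.single (a, b) 1
       - Poly_Mapping.single (a', b) 1 | a a' b. True} \<union>
    {Poly_Mapping.single (a, b + b') 1 - Poly_Mapping.single (a, b) 1
       - Poly_Mapping.single (a, b') 1 | a b b'. True} \<union>
    {Poly_Mapping.single (c *\<^sub>C a, b) 1 - Poly_Mapping.single (a, b) c | a b c. True} \<union>
    {Poly_Mapping.single (a, c *\<^sub>C b) 1 - Poly_Mapping.single (a, b) c | a b c. True}"

definition tensor_eq ::
    "('a::complex_vector \<times> 'b::complex_vector \<Rightarrow>\<^sub>0 complex) \<Rightarrow> ('a \<times> 'b \<Rightarrow>\<^sub>0 complex) \<Rightarrow> bool"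
  where "tensor_eq p q \<longleftrightarrow> p - q \<in> free_cvec.span tensor_relators"

lemma tensor_eq_equivp: "equivp tensor_eq"
proof (rule equivpI)
  show "reflp tensor_eq"
    by (rule reflpI) (simp add: tensor_eq_def free_cvec.span_zero)
  show "symp tensor_eq"
    unfolding tensor_eq_def by (rule sympI, drule free_cvec.span_neg) simp
  show "transp tensor_eq"
    unfolding tensor_eq_def by (rule transpI, drule (1) free_cvec.span_add) simp
qed

quotient_type (overloaded) ('a, 'b) tensor =
  "('a::complex_vector \<times> 'b::complex_vector) \<Rightarrow>\<^sub>0 complex" / tensor_eq
  by (rule tensor_eq_equivp)

instantiation tensor :: (complex_vector, complex_vector) complex_vector
begin

lift_definition zero_tensor :: "('a, 'b) tensor" is 0 .

lift_definition plus_tensor :: "('a, 'b) tensor \<Rightarrow> ('a, 'b) tensor \<Rightarrow> ('a, 'b) tensor" is "(+)"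
  unfolding tensor_eq_def by (subst add_diff_add) (rule free_cvec.span_add)

lift_definition uminus_tensor :: "('a, 'b) tensor \<Rightarrow> ('a, 'b) tensor" is uminus
  unfolding tensor_eq_def by (drule free_cvec.span_neg) simp

lift_definition minus_tensor :: "('a, 'b) tensor \<Rightarrow> ('a, 'b) tensor \<Rightarrow> ('a, 'b) tensor" is "(-)"
proof -
  fix p p' q q' :: "('a \<times> 'b) \<Rightarrow>\<^sub>0 complex"
  assume "tensor_eq p p'" "tensor_eq q q'"
  then have "(p - p') - (q - q') \<in> free_cvec.span tensor_relators"
    unfolding tensor_eq_def by (rule free_cvec.span_diff)
  then show "tensor_eq (p - q) (p' - q')"
    unfolding tensor_eq_def by (simp add: algebra_simps)
qed

lift_definition scaleC_tensor :: "complex \<Rightarrow> ('a, 'b) tensor \<Rightarrow> ('a, 'b) tensor" is free_scale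
  unfolding tensor_eq_def
  by (subst free_cvec.scale_right_diff_distrib[symmetric]) (rule free_cvec.span_scale)

instance
proof
  fix x y z :: "('a, 'b) tensor" and c d :: complex
  note refl = equivp_reflp[OF tensor_eq_equivp]
  show "x + y + z = x + (y + z)" by transfer (simp add: add.assoc refl)
  show "x + y = y + x" by transfer (simp add: add.commute refl)
  show "0 + x = x" by transfer (simp add: refl)
  show "- x + x = 0" by transfer (simp add: refl)
  show "x - y = x + - y" by transfer (simp add: refl)
  show "c *\<^sub>C (x + y) = c *\<^sub>C x + c *\<^sub>C y"
    by transfer (simp add: free_cvec.scale_right_distrib refl)
  show "(c + d) *\<^sub>C x = c *\<^sub>C x + d *\<^sub>C x"
    by transfer (simp add: free_cvec.scale_left_distrib refl)
  show "c *\<^sub>C (d *\<^sub>C x) = (c * d) *\<^sub>C x" by transfer (simp add: refl)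
  show "1 *\<^sub>C x = x" by transfer (simp add: refl)
qed

end

lift_definition tensor_pure :: "'a::complex_vector \<Rightarrow> 'b::complex_vector \<Rightarrow> ('a, 'b) tensor"
    (infixr \<open>\<otimes>\<close> 70)
  is "\<lambda>a b. Poly_Mapping.single (a, b) 1" .

lemma tensor_pure_add_left: "(a + a') \<otimes> b = a \<otimes> b + a' \<otimes> b"
  by (transfer, unfold tensor_eq_def diff_diff_add[symmetric], rule free_cvec.span_base)
    (unfold tensor_relators_def, blast)

lemma tensor_pure_add_right: "a \<otimes> (b + b') = a \<otimes> b + a \<otimes> b'"
  by (transfer, unfold tensor_eq_def diff_diff_add[symmetric], rule free_cvec.span_base)
    (unfold tensor_relators_def, blast)

lemma free_scale_single: "free_scale c (Poly_Mapping.single k d) = Poly_Mapping.single k (c * d)"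
  by (rule poly_mapping_eqI) (simp add: Poly_Mapping.lookup_single when_def)

lemma tensor_pure_scale_left: "(c *\<^sub>C a) \<otimes> b = c *\<^sub>C (a \<otimes> b)"
  by (transfer, unfold tensor_eq_def free_scale_single mult_1_right, rule free_cvec.span_base)
    (unfold tensor_relators_def, blast)

lemma tensor_pure_scale_right: "a \<otimes> (c *\<^sub>C b) = c *\<^sub>C (a \<otimes> b)"
  by (transfer, unfold tensor_eq_def free_scale_single mult_1_right, rule free_cvec.span_base)
    (unfold tensor_relators_def, blast)

text \<open>
  The image of \<open>V \<otimes> W\<close> in the full tensor product; over a field this is the tensor product of
  the subspaces \<open>V\<close> and \<open>W\<close>.
\<close>

definition tensor_sum :: "('a::complex_vector \<times> 'b::complex_vector) list \<Rightarrow> ('a, 'b) tensor"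
  where "tensor_sum xs = (\<Sum>(a, b)\<leftarrow>xs. a \<otimes> b)"

definition tensor_space :: "'a set \<Rightarrow> 'b set \<Rightarrow> ('a::complex_vector, 'b::complex_vector) tensor set"
  where "tensor_space V W = {tensor_sum xs | xs. set xs \<subseteq> V \<times> W}"

text \<open>
  The map on \<open>V \<otimes> W\<close> induced by \<open>B\<close>. It is required of \<open>B\<close> only that it be biadditive and balanced
  on \<open>V \<times> W\<close>, so that conjugate-linear maps are covered as well; see \<open>tensor_lift_tensor_sum\<close>
  below. Arguments outside \<open>V \<otimes> W\<close> have an unspecified value.
\<close>

definition tensor_lift ::
    "'a set \<Rightarrow> 'b set \<Rightarrow> ('a::complex_vector \<Rightarrow> 'b::complex_vector \<Rightarrow> 'c::ab_group_add)
      \<Rightarrow> ('a, 'b) tensor \<Rightarrow> 'c"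
  where "tensor_lift V W B x =
    (THE y. \<exists>xs. set xs \<subseteq> V \<times> W \<and> x = tensor_sum xs \<and> y = (\<Sum>(a, b)\<leftarrow>xs. B a b))"

definition balanced_on ::
    "'a set \<Rightarrow> 'b set \<Rightarrow> ('a::complex_vector \<Rightarrow> 'b::complex_vector \<Rightarrow> 'c::ab_group_add) \<Rightarrow> bool"
  where "balanced_on V W B \<longleftrightarrow>
    (\<forall>a\<in>V. \<forall>a'\<in>V. \<forall>b\<in>W. B (a + a') b = B a b + B a' b) \<and>
    (\<forall>a\<in>V. \<forall>b\<in>W. \<forall>b'\<in>W. B a (b + b') = B a b + B a b') \<and>
    (\<forall>c. \<forall>a\<in>V. \<forall>b\<in>W. B (c *\<^sub>C a) b = B a (c *\<^sub>C b))"

context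
  fixes B :: "'a::complex_vector \<Rightarrow> 'b::complex_vector \<Rightarrow> 'c::ab_group_add"
  assumes bal: "balanced_on UNIV UNIV B"
begin

private lemma add_left: "B (a + a') b = B a b + B a' b"
  and add_right: "B a (b + b') = B a b + B a b'"
  and balanced: "B (c *\<^sub>C a) b = B a (c *\<^sub>C b)"
  using bal by (auto simp: balanced_on_def)

private lemma zero_left: "B 0 b = 0"
  using add_left[of 0 0 b] by simp

private lemma diff_left: "B (a - a') b = B a b - B a' b"
  using add_left[of "a - a'" a' b] by simp

private definition free_lift :: "('a \<times> 'b \<Rightarrow>\<^sub>0 complex) \<Rightarrow> 'c"
  where "free_lift p =
    (\<Sum>k\<in>Poly_Mapping.keys p. B (Poly_Mapping.lookup p k *\<^sub>C fst k) (snd k))"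

private lemma free_lift_superset:
  assumes "finite K" "Poly_Mapping.keys p \<subseteq> K"
  shows "free_lift p = (\<Sum>k\<in>K. B (Poly_Mapping.lookup p k *\<^sub>C fst k) (snd k))"
  unfolding free_lift_def
  by (rule sum.mono_neutral_left) (use assms in \<open>auto simp: in_keys_iff zero_left\<close>)

private lemma free_lift_add: "free_lift (p + q) = free_lift p + free_lift q"
proof -
  let ?K = "Poly_Mapping.keys p \<union> Poly_Mapping.keys q"
  have "Poly_Mapping.keys (p + q) \<subseteq> ?K"
    by (rule Poly_Mapping.keys_add)
  then show ?thesis
    by (simp add: free_lift_superset[of ?K] Poly_Mapping.lookup_add complex_vector.scale_left_distrib
        add_left sum.distrib)
qed

private lemma free_lift_zero: "free_lift 0 = 0"
  by (simp add: free_lift_def)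

private lemma free_lift_diff: "free_lift (p - q) = free_lift p - free_lift q"
  using free_lift_add[of "p - q" q] by simp

private lemma free_lift_single: "free_lift (Poly_Mapping.single (a, b) c) = B (c *\<^sub>C a) b"
  by (simp add: free_lift_superset[of "{(a, b)}"])

private lemma free_lift_relator:
  assumes "p \<in> tensor_relators"
  shows "free_lift (free_scale c p) = 0"
  using assms
  by (auto simp: tensor_relators_def free_cvec.scale_right_diff_distrib free_scale_single
      free_lift_diff free_lift_single complex_vector.scale_right_distrib add_left add_right
      balanced mult.commute)

private lemma free_lift_span:
  assumes "p \<in> free_cvec.span tensor_relators"
  shows "free_lift p = 0"
proof -
  have "free_cvec.subspace {q. \<forall>c. free_lift (free_scale c q) = 0}"
    by (auto simp: free_cvec.subspace_def free_cvec.scale_right_distrib free_lift_add free_lift_zero)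
  then have "free_cvec.span tensor_relators \<subseteq> {q. \<forall>c. free_lift (free_scale c q) = 0}"
    by (intro free_cvec.span_minimal) (auto simp: free_lift_relator)
  with assms have "free_lift (free_scale 1 p) = 0"
    by blast
  then show ?thesis by simp
qed

lemma ex_tensor_map: "\<exists>F. \<forall>xs. F (tensor_sum xs) = (\<Sum>(a, b)\<leftarrow>xs. B a b)"
proof -
  define F where "F x = free_lift (rep_tensor x)" for x
  have rep: "free_lift (rep_tensor (abs_tensor p)) = free_lift p" for p
  proof -
    have "tensor_eq (rep_tensor (abs_tensor p)) p"
      by (rule Quotient3_rep_abs[OF Quotient3_tensor]) (rule equivp_reflp[OF tensor_eq_equivp])
    then show ?thesis
      using free_lift_span free_lift_diff unfolding tensor_eq_def by fastforce
  qed
  have pure: "F (a \<otimes> b) = B a b" for a b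
    by (simp add: F_def tensor_pure.abs_eq rep free_lift_single)
  have add: "F (x + y) = F x + F y" for x y
  proof -
    have "x + y = abs_tensor (rep_tensor x + rep_tensor y)"
      by (metis Quotient3_abs_rep[OF Quotient3_tensor] plus_tensor.abs_eq)
    then show ?thesis
      by (simp add: F_def rep free_lift_add)
  qed
  have zero: "F 0 = 0"
    using add[of 0 0] by simp
  have "F (tensor_sum xs) = (\<Sum>(a, b)\<leftarrow>xs. B a b)" for xs
    by (induction xs) (auto simp: tensor_sum_def zero add pure)
  then show ?thesis by blast
qed

end

lemma ex_projection:
  assumes "complex_vector.subspace V"
  shows "\<exists>P. clinear P \<and> range P \<subseteq> V \<and> (\<forall>v\<in>V. P v = v)"
proof -
  interpret vp: vector_space_pair "scaleC :: complex \<Rightarrow> 'a \<Rightarrow> 'a" "scaleC :: complex \<Rightarrow> 'a \<Rightarrow> 'a"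
    by unfold_locales
  have "Vector_Spaces.linear scaleC scaleC (\<lambda>x::'a. x)"
    by (rule complex_vector.linear_ident)
  from vp.linear_exists_left_inverse_on[OF this assms]
  obtain P where P: "range P \<subseteq> V" "Vector_Spaces.linear scaleC scaleC P" "\<forall>v\<in>V. P v = v"
    by (auto simp: inj_on_def)
  then have "clinear P"
    by (auto simp: clinear_on_def Vector_Spaces.linear_iff)
  with P show ?thesis by blast
qed

lemma tensor_lift_tensor_sum:
  assumes V: "complex_vector.subspace V" and W: "complex_vector.subspace W"
    and B: "balanced_on V W B" and xs: "set xs \<subseteq> V \<times> W"
  shows "tensor_lift V W B (tensor_sum xs) = (\<Sum>(a, b)\<leftarrow>xs. B a b)"
proof -
  obtain P where P: "clinear P" "range P \<subseteq> V" "\<forall>v\<in>V. P v = v"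
    using ex_projection[OF V] by blast
  obtain Q where Q: "clinear Q" "range Q \<subseteq> W" "\<forall>w\<in>W. Q w = w"
    using ex_projection[OF W] by blast
  have mem: "P a \<in> V" "Q b \<in> W" for a b
    using P Q by auto
  have "balanced_on UNIV UNIV (\<lambda>a b. B (P a) (Q b))"
    using B P(1) Q(1) mem by (simp add: balanced_on_def clinear_on_def)
  then obtain F where F: "\<And>ys. F (tensor_sum ys) = (\<Sum>(a, b)\<leftarrow>ys. B (P a) (Q b))"
    using ex_tensor_map by blast
  have eq: "F (tensor_sum ys) = (\<Sum>(a, b)\<leftarrow>ys. B a b)" if "set ys \<subseteq> V \<times> W" for ys
    unfolding F
    by (rule arg_cong[where f = sum_list], rule map_cong) (use that P(3) Q(3) in auto)
  show ?thesis
    unfolding tensor_lift_def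
  proof (rule the_equality)
    fix y assume "\<exists>ys. set ys \<subseteq> V \<times> W \<and> tensor_sum xs = tensor_sum ys \<and> y = (\<Sum>(a, b)\<leftarrow>ys. B a b)"
    then show "y = (\<Sum>(a, b)\<leftarrow>xs. B a b)"
      using eq xs by metis
  qed (use xs in blast)
qed

lemma tensor_space_UNIV: "tensor_space UNIV UNIV = UNIV"
proof -
  have "\<exists>xs. abs_tensor p = tensor_sum xs" for p :: "'a \<times> 'b \<Rightarrow>\<^sub>0 complex"
  proof (induction p rule: Poly_Mapping.update_induct)
    case const
    have "abs_tensor 0 = tensor_sum ([] :: ('a \<times> 'b) list)"
      by (simp add: tensor_sum_def zero_tensor.abs_eq)
    then show ?case by blast
  next
    case (update p k c)
    obtain xs where xs: "abs_tensor p = tensor_sum xs"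
      using update by blast
    have "Poly_Mapping.update k c p = free_scale c (Poly_Mapping.single k 1) + p"
      using update(1)
      by (intro poly_mapping_eqI)
        (auto simp: lookup_update Poly_Mapping.lookup_add Poly_Mapping.lookup_single in_keys_iff when_def)
    then have "abs_tensor (Poly_Mapping.update k c p)
        = c *\<^sub>C abs_tensor (Poly_Mapping.single k 1) + abs_tensor p"
      by (simp add: plus_tensor.abs_eq scaleC_tensor.abs_eq)
    also have "\<dots> = tensor_sum ((c *\<^sub>C fst k, snd k) # xs)"
      using tensor_pure.abs_eq[of "fst k" "snd k"]
      by (simp add: xs tensor_sum_def tensor_pure_scale_left)
    finally show ?case by blast
  qed
  then have "\<exists>xs. x = tensor_sum xs" for x :: "('a, 'b) tensor"
    by (metis Quotient3_abs_rep[OF Quotient3_tensor])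
  then show ?thesis
    by (auto simp: tensor_space_def)
qed

abbreviation tensor_lift_UNIV ::
    "('a::complex_vector \<Rightarrow> 'b::complex_vector \<Rightarrow> 'c::ab_group_add) \<Rightarrow> ('a, 'b) tensor \<Rightarrow> 'c"
  where "tensor_lift_UNIV \<equiv> tensor_lift UNIV UNIV"

definition tensor_mult :: "('a::complex_algebra_1, 'b::complex_algebra_1) tensor \<Rightarrow> ('a, 'b) tensor
    \<Rightarrow> ('a, 'b) tensor"
  where "tensor_mult x y =
    tensor_lift_UNIV (\<lambda>a b. tensor_lift_UNIV (\<lambda>c d. (a * c) \<otimes> (b * d)) y) x"

definition tensor_assoc ::
    "(('a::complex_vector, 'b::complex_vector) tensor, 'c::complex_vector) tensor
      \<Rightarrow> ('a, ('b, 'c) tensor) tensor"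
  where "tensor_assoc = tensor_lift_UNIV (\<lambda>x c. tensor_lift_UNIV (\<lambda>a b. a \<otimes> b \<otimes> c) x)"


section \<open>Compact quantum groups and idempotent states\<close>

locale hopf_star_algebra =
  fixes star :: "'a::complex_algebra_1 \<Rightarrow> 'a"
    and \<Delta> :: "'a \<Rightarrow> ('a, 'a) tensor"
    and \<epsilon> :: "'a \<Rightarrow> complex"
    and antipode :: "'a \<Rightarrow> 'a"
  assumes star_star: "star (star x) = x"
    and star_add: "star (x + y) = star x + star y"
    and star_scale: "star (c *\<^sub>C x) = cnj c *\<^sub>C star x"
    and star_mult: "star (x * y) = star y * star x"
    and comult_linear: "clinear \<Delta>"
    and comult_one: "\<Delta> 1 = 1 \<otimes> 1"
    and comult_mult: "\<Delta> (x * y) = tensor_mult (\<Delta> x) (\<Delta> y)"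
    and comult_star: "\<Delta> (star x) = tensor_lift_UNIV (\<lambda>a b. star a \<otimes> star b) (\<Delta> x)"
    and comult_coassoc:
      "tensor_assoc (tensor_lift_UNIV (\<lambda>a b. \<Delta> a \<otimes> b) (\<Delta> x)) = tensor_lift_UNIV (\<lambda>a b. a \<otimes> \<Delta> b) (\<Delta> x)"
    and counit_linear: "clinear \<epsilon>"
    and counit_one: "\<epsilon> 1 = 1"
    and counit_mult: "\<epsilon> (x * y) = \<epsilon> x * \<epsilon> y"
    and counit_left: "tensor_lift_UNIV (\<lambda>a b. \<epsilon> a *\<^sub>C b) (\<Delta> x) = x"
    and counit_right: "tensor_lift_UNIV (\<lambda>a b. \<epsilon> b *\<^sub>C a) (\<Delta> x) = x"
    and antipode_linear: "clinear antipode"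
    and antipode_left: "tensor_lift_UNIV (\<lambda>a b. antipode a * b) (\<Delta> x) = \<epsilon> x *\<^sub>C 1"
    and antipode_right: "tensor_lift_UNIV (\<lambda>a b. a * antipode b) (\<Delta> x) = \<epsilon> x *\<^sub>C 1"

definition unitary_corepresentation ::
    "('a::complex_algebra_1 \<Rightarrow> 'a) \<Rightarrow> ('a \<Rightarrow> ('a, 'a) tensor) \<Rightarrow> ('a \<Rightarrow> complex)
      \<Rightarrow> nat \<Rightarrow> (nat \<Rightarrow> nat \<Rightarrow> 'a) \<Rightarrow> bool"
  where "unitary_corepresentation star \<Delta> \<epsilon> n u \<longleftrightarrow>
    (\<forall>i<n. \<forall>j<n. \<Delta> (u i j) = (\<Sum>k<n. u i k \<otimes> u k j)) \<and>
    (\<forall>i<n. \<forall>j<n. \<epsilon> (u i j) = (if i = j then 1 else 0)) \<and>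
    (\<forall>i<n. \<forall>j<n. (\<Sum>k<n. u i k * star (u j k)) = (if i = j then 1 else 0)) \<and>
    (\<forall>i<n. \<forall>j<n. (\<Sum>k<n. star (u k i) * u k j) = (if i = j then 1 else 0))"

text \<open>
  A compact quantum group enters through its canonical dense Hopf \<open>*\<close>-algebra. By
  Dijkhuizen and Koornwinder, the algebras arising in this way are exactly the CQG algebras: the
  Hopf \<open>*\<close>-algebras spanned by the coefficients of their finite-dimensional unitary
  corepresentations.
\<close>

locale cqg_algebra = hopf_star_algebra star \<Delta> \<epsilon> antipode
  for star :: "'a::complex_algebra_1 \<Rightarrow> 'a"
    and \<Delta> :: "'a \<Rightarrow> ('a, 'a) tensor"
    and \<epsilon> :: "'a \<Rightarrow> complex"
    and antipode :: "'a \<Rightarrow> 'a" +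
  assumes spanned_by_coefficients:
    "complex_vector.span {u i j | n u i j. unitary_corepresentation star \<Delta> \<epsilon> n u \<and> i < n \<and> j < n} = UNIV"

definition convolution ::
    "('a::complex_vector \<Rightarrow> ('a, 'a) tensor) \<Rightarrow> ('a \<Rightarrow> complex) \<Rightarrow> ('a \<Rightarrow> complex) \<Rightarrow> 'a \<Rightarrow> complex"
  where "convolution \<Delta> \<mu> \<nu> x = tensor_lift_UNIV (\<lambda>a b. \<mu> a * \<nu> b) (\<Delta> x)"

definition idempotent_state ::
    "('a::complex_algebra_1 \<Rightarrow> 'a) \<Rightarrow> ('a \<Rightarrow> ('a, 'a) tensor) \<Rightarrow> ('a \<Rightarrow> complex) \<Rightarrow> bool"
  where "idempotent_state star \<Delta> \<Phi> \<longleftrightarrow>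
    clinear \<Phi> \<and> \<Phi> 1 = 1 \<and>
    (\<forall>a. Im (\<Phi> (star a * a)) = 0 \<and> Re (\<Phi> (star a * a)) \<ge> 0) \<and>
    convolution \<Delta> \<Phi> \<Phi> = \<Phi>"

text \<open>\<open>E_left\<close> and \<open>E_right\<close> use the identifications of \<open>\<complex> \<otimes> A\<close> and \<open>A \<otimes> \<complex>\<close> with \<open>A\<close>.\<close>

definition E_left :: "('a::complex_vector \<Rightarrow> ('a, 'a) tensor) \<Rightarrow> ('a \<Rightarrow> complex) \<Rightarrow> 'a \<Rightarrow> 'a"
  where "E_left \<Delta> \<Phi> x = tensor_lift_UNIV (\<lambda>a b. \<Phi> a *\<^sub>C b) (\<Delta> x)"

definition E_right :: "('a::complex_vector \<Rightarrow> ('a, 'a) tensor) \<Rightarrow> ('a \<Rightarrow> complex) \<Rightarrow> 'a \<Rightarrow> 'a"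
  where "E_right \<Delta> \<Phi> x = tensor_lift_UNIV (\<lambda>a b. \<Phi> b *\<^sub>C a) (\<Delta> x)"

definition O_left :: "('a::complex_vector \<Rightarrow> ('a, 'a) tensor) \<Rightarrow> ('a \<Rightarrow> complex) \<Rightarrow> 'a set"
  where "O_left \<Delta> \<Phi> = range (E_left \<Delta> \<Phi>)"

definition O_right :: "('a::complex_vector \<Rightarrow> ('a, 'a) tensor) \<Rightarrow> ('a \<Rightarrow> complex) \<Rightarrow> 'a set"
  where "O_right \<Delta> \<Phi> = range (E_right \<Delta> \<Phi>)"

definition O_bi :: "('a::complex_vector \<Rightarrow> ('a, 'a) tensor) \<Rightarrow> ('a \<Rightarrow> complex) \<Rightarrow> 'a set"
  where "O_bi \<Delta> \<Phi> = O_left \<Delta> \<Phi> \<inter> O_right \<Delta> \<Phi>"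


section \<open>Invariance and convolution\<close>

text \<open>
  The coaction on \<open>O_left\<close> is the restriction of \<open>\<Delta>\<close>, so its values are read in
  \<open>O_left \<otimes> A\<close>.
\<close>

definition Phi_invariant ::
    "('a::complex_vector \<Rightarrow> ('a, 'a) tensor) \<Rightarrow> ('a \<Rightarrow> complex) \<Rightarrow> ('a \<Rightarrow> complex) \<Rightarrow> bool"
  where "Phi_invariant \<Delta> \<Phi> f \<longleftrightarrow>
    (\<forall>x\<in>O_left \<Delta> \<Phi>. tensor_lift (O_left \<Delta> \<Phi>) UNIV (\<lambda>a b. f a * \<Phi> b) (\<Delta> x) = f x)"

definition Phi_bi_invariant ::
    "('a::complex_vector \<Rightarrow> ('a, 'a) tensor) \<Rightarrow> ('a \<Rightarrow> complex) \<Rightarrow> ('a \<Rightarrow> complex) \<Rightarrow> bool"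
  where "Phi_bi_invariant \<Delta> \<Phi> \<mu> \<longleftrightarrow> convolution \<Delta> \<Phi> \<mu> = \<mu> \<and> convolution \<Delta> \<mu> \<Phi> = \<mu>"

definition G_invariant ::
    "('a::complex_vector \<Rightarrow> ('a, 'a) tensor) \<Rightarrow> ('a \<Rightarrow> complex) \<Rightarrow> ('a \<Rightarrow> 'a) \<Rightarrow> bool"
  where "G_invariant \<Delta> \<Phi> T \<longleftrightarrow>
    (\<forall>x\<in>O_left \<Delta> \<Phi>. tensor_lift (O_left \<Delta> \<Phi>) UNIV (\<lambda>a b. T a \<otimes> b) (\<Delta> x) = \<Delta> (T x))"

definition convolution_left ::
    "('a::complex_vector \<Rightarrow> ('a, 'a) tensor) \<Rightarrow> ('a \<Rightarrow> complex)
      \<Rightarrow> ('a \<Rightarrow> complex) \<Rightarrow> ('a \<Rightarrow> complex) \<Rightarrow> 'a \<Rightarrow> complex"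
  where "convolution_left \<Delta> \<Phi> f g x =
    tensor_lift (O_left \<Delta> \<Phi>) UNIV (\<lambda>a b. f a * g (E_left \<Delta> \<Phi> b)) (\<Delta> x)"

definition comult_bi ::
    "('a::complex_vector \<Rightarrow> ('a, 'a) tensor) \<Rightarrow> ('a \<Rightarrow> complex) \<Rightarrow> 'a \<Rightarrow> ('a, 'a) tensor"
  where "comult_bi \<Delta> \<Phi> x =
    tensor_lift_UNIV (\<lambda>a y. a \<otimes> tensor_lift_UNIV (\<lambda>b c. \<Phi> b *\<^sub>C c) y)
      (tensor_lift_UNIV (\<lambda>a b. a \<otimes> \<Delta> b) (\<Delta> x))"

definition convolution_bi ::
    "('a::complex_vector \<Rightarrow> ('a, 'a) tensor) \<Rightarrow> ('a \<Rightarrow> complex)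
      \<Rightarrow> ('a \<Rightarrow> complex) \<Rightarrow> ('a \<Rightarrow> complex) \<Rightarrow> 'a \<Rightarrow> complex"
  where "convolution_bi \<Delta> \<Phi> f g x =
    tensor_lift (O_bi \<Delta> \<Phi>) (O_bi \<Delta> \<Phi>) (\<lambda>a b. f a * g b) (comult_bi \<Delta> \<Phi> x)"


section \<open>Semigroups\<close>

text \<open>
  Maps on a subspace, and families indexed by \<open>t \<ge> 0\<close>, are represented by functions that are
  \<open>undefined\<close> outside their domain, so that equality of these functions is equality on the domain.
\<close>

definition linear_functionals :: "'a::complex_vector set \<Rightarrow> ('a \<Rightarrow> complex) set"
  where "linear_functionals V = {f \<in> extensional V. clinear_on V f}"

definition linear_operators :: "'a::complex_vector set \<Rightarrow> ('a \<Rightarrow> 'a) set"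
  where "linear_operators V = {T \<in> V \<rightarrow>\<^sub>E V. clinear_on V T}"

definition weakly_continuous :: "'a set \<Rightarrow> (real \<Rightarrow> 'a \<Rightarrow> complex) \<Rightarrow> bool"
  where "weakly_continuous V f \<longleftrightarrow> (\<forall>a\<in>V. ((\<lambda>t. f t a) \<longlongrightarrow> f 0 a) (at_right 0))"

definition convolution_semigroups ::
    "'a::complex_vector set \<Rightarrow> (('a \<Rightarrow> complex) \<Rightarrow> ('a \<Rightarrow> complex) \<Rightarrow> 'a \<Rightarrow> complex)
      \<Rightarrow> (real \<Rightarrow> 'a \<Rightarrow> complex) set"
  where "convolution_semigroups V conv =
    {f \<in> {0..} \<rightarrow>\<^sub>E linear_functionals V. weakly_continuous V f \<and>
      (\<forall>s\<ge>0. \<forall>t\<ge>0. \<forall>x\<in>V. conv (f s) (f t) x = f (s + t) x)}"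

definition invariant_operator_semigroups ::
    "('a::complex_vector \<Rightarrow> ('a, 'a) tensor) \<Rightarrow> ('a \<Rightarrow> complex) \<Rightarrow> ('a \<Rightarrow> complex) \<Rightarrow> (real \<Rightarrow> 'a \<Rightarrow> 'a) set"
  where "invariant_operator_semigroups \<Delta> \<epsilon> \<Phi> =
    {T \<in> {0..} \<rightarrow>\<^sub>E linear_operators (O_left \<Delta> \<Phi>).
      (\<forall>t\<ge>0. G_invariant \<Delta> \<Phi> (T t)) \<and>
      (\<forall>s\<ge>0. \<forall>t\<ge>0. \<forall>x\<in>O_left \<Delta> \<Phi>. T (s + t) x = T s (T t x)) \<and>
      weakly_continuous (O_left \<Delta> \<Phi>) (\<lambda>t x. \<epsilon> (T t x))}"

definition invariant_semigroups ::
    "('a::complex_vector \<Rightarrow> ('a, 'a) tensor) \<Rightarrow> ('a \<Rightarrow> complex) \<Rightarrow> (real \<Rightarrow> 'a \<Rightarrow> complex) set"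
  where "invariant_semigroups \<Delta> \<Phi> =
    {f \<in> convolution_semigroups (O_left \<Delta> \<Phi>) (convolution_left \<Delta> \<Phi>).
      \<forall>t\<ge>0. Phi_invariant \<Delta> \<Phi> (f t)}"

definition bi_invariant_semigroups ::
    "('a::complex_vector \<Rightarrow> ('a, 'a) tensor) \<Rightarrow> ('a \<Rightarrow> complex) \<Rightarrow> (real \<Rightarrow> 'a \<Rightarrow> complex) set"
  where "bi_invariant_semigroups \<Delta> \<Phi> =
    {\<mu> \<in> convolution_semigroups UNIV (convolution \<Delta>). \<forall>t\<ge>0. Phi_bi_invariant \<Delta> \<Phi> (\<mu> t)}"

definition double_coset_semigroups ::
    "('a::complex_vector \<Rightarrow> ('a, 'a) tensor) \<Rightarrow> ('a \<Rightarrow> complex) \<Rightarrow> (real \<Rightarrow> 'a \<Rightarrow> complex) set"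
  where "double_coset_semigroups \<Delta> \<Phi> = convolution_semigroups (O_bi \<Delta> \<Phi>) (convolution_bi \<Delta> \<Phi>)"

definition one_to_one_correspondence ::
    "'x set \<Rightarrow> 'y set \<Rightarrow> ('x \<Rightarrow> 'y) \<Rightarrow> ('y \<Rightarrow> 'x) \<Rightarrow> bool"
  where "one_to_one_correspondence X Y F G \<longleftrightarrow>
    bij_betw F X Y \<and> bij_betw G Y X \<and> (\<forall>x\<in>X. G (F x) = x) \<and> (\<forall>y\<in>Y. F (G y) = y)"

end

theory Submission
  imports Defs
begin

text \<open>
  Every linear functional \<open>\<mu>\<close> on a coalgebra has two slice maps, \<open>L\<^sub>\<mu> = (\<mu> \<otimes> id) \<circ> \<Delta>\<close> and
  \<open>R\<^sub>\<mu> = (id \<otimes> \<mu>) \<circ> \<Delta>\<close>, which are \<open>E_left \<Delta> \<mu>\<close> and \<open>E_right \<Delta> \<mu>\<close> below. Coassociativity gives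
  \<open>\<mu> \<star> \<nu> = \<nu> \<circ> L\<^sub>\<mu> = \<mu> \<circ> R\<^sub>\<nu>\<close>, makes all \<open>L\<^sub>\<mu>\<close> commute with all \<open>R\<^sub>\<nu>\<close>, and turns convolution into
  composition of slice maps, \<open>L\<^sub>\<nu> \<circ> L\<^sub>\<mu> = L\<^sub>\<mu>\<^sub>\<star>\<^sub>\<nu>\<close>. The counit recovers a functional from its slice map,
  \<open>\<epsilon> \<circ> L\<^sub>\<mu> = \<mu>\<close>. An idempotent functional \<open>\<Phi>\<close> thus yields commuting projections \<open>E = L\<^sub>\<Phi>\<close> and
  \<open>F = R\<^sub>\<Phi>\<close>, and a functional \<open>\<mu>\<close> is \<open>\<Phi>\<close>-bi-invariant exactly if \<open>\<mu> \<circ> E = \<mu> = \<mu> \<circ> F\<close>.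

  For this reason bi-invariant functionals are determined by their restrictions to the range of \<open>E\<close>,
  or to the range of \<open>E \<circ> F\<close>, and a functional on one of these subspaces is extended by
  precomposing it with the projection. Invariance of a functional \<open>f\<close> on the range of \<open>E\<close> is
  bi-invariance of \<open>f \<circ> E\<close> (\<open>Phi_invariant_iff_bi_invariant\<close>). The convolutions on the two subspaces
  are the ordinary convolution of the extended functionals (\<open>convolution_left_eq\<close>,
  \<open>convolution_bi_eq\<close>), because \<open>\<Delta>\<close> sends \<open>E x\<close> to \<open>(E \<otimes> id) (\<Delta> x)\<close> and, on the range of \<open>E \<circ> F\<close>, the
  coproduct \<open>comult_bi\<close> is \<open>(E F \<otimes> E F) \<circ> \<Delta>\<close>. This identifies the three kinds of semigroups of
  functionals.

  For the operators, applying \<open>\<epsilon> \<otimes> id\<close> to the invariance equation \<open>(T \<otimes> id) \<circ> \<Delta> = \<Delta> \<circ> T\<close> shows that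
  \<open>T\<close> is the slice map of \<open>\<epsilon> \<circ> T \<circ> E\<close> (\<open>G_invariant_eq_slice\<close>). Conversely, the slice map of a
  bi-invariant functional preserves the range of \<open>E\<close> and is invariant. Composition of slice maps
  corresponds to convolution in the opposite order. On a semigroup this reversal is harmless,
  because \<open>s + t = t + s\<close>.
\<close>


section \<open>Linear and bilinear maps\<close>

lemma clinear_onI:
  assumes "\<And>x y. x \<in> V \<Longrightarrow> y \<in> V \<Longrightarrow> f (x + y) = f x + f y"
    and "\<And>c x. x \<in> V \<Longrightarrow> f (c *\<^sub>C x) = c *\<^sub>C f x"
  shows "clinear_on V f"
  using assms by (auto simp: clinear_on_def)

lemma clinear_add: "clinear f \<Longrightarrow> f (x + y) = f x + f y"
  and clinear_scale: "clinear f \<Longrightarrow> f (c *\<^sub>C x) = c *\<^sub>C f x"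
  by (auto simp: clinear_on_def)

lemma clinear_zero: "clinear f \<Longrightarrow> f 0 = 0"
  using clinear_add[of f 0 0] by simp

lemma clinear_sum_list: "clinear f \<Longrightarrow> f (\<Sum>x\<leftarrow>xs. g x) = (\<Sum>x\<leftarrow>xs. f (g x))"
  by (induction xs) (auto simp: clinear_zero clinear_add)

lemma clinear_on_compose:
  assumes "clinear_on V f" "clinear h" "\<And>x. h x \<in> V"
  shows "clinear (\<lambda>x. f (h x))"
  using assms by (auto simp: clinear_on_def)

lemma clinear_range_subspace:
  assumes "clinear f"
  shows "complex_vector.subspace (range f)"
  unfolding complex_vector.subspace_def
proof (intro conjI ballI allI)
  show "0 \<in> range f"
    by (rule range_eqI[of _ _ 0]) (simp add: clinear_zero[OF assms])
next
  fix y z assume "y \<in> range f" "z \<in> range f"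
  then show "y + z \<in> range f"
    by (auto simp: clinear_add[OF assms, symmetric])
next
  fix c y assume "y \<in> range f"
  then show "c *\<^sub>C y \<in> range f"
    by (auto simp: clinear_scale[OF assms, symmetric])
qed

named_theorems clinear_intros

lemma clinear_ident [clinear_intros]: "clinear (\<lambda>x. x)"
  by (simp add: clinear_on_def)

lemma clinear_scaleC_right [clinear_intros]: "clinear_on V f \<Longrightarrow> clinear_on V (\<lambda>x. c *\<^sub>C f x)"
  by (simp add: clinear_on_def scaleC_add_right scaleC_scaleC mult.commute)

lemma clinear_scaleC_left [clinear_intros]: "clinear_on V f \<Longrightarrow> clinear_on V (\<lambda>x. f x *\<^sub>C v)"
  by (simp add: clinear_on_def scaleC_add_left scaleC_scaleC scaleC_complex_def)

lemma clinear_times_right [clinear_intros]: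
  "clinear_on V f \<Longrightarrow> clinear_on V (\<lambda>x. c * f x :: complex)"
  by (simp add: clinear_on_def scaleC_complex_def algebra_simps)

lemma clinear_times_left [clinear_intros]:
  "clinear_on V f \<Longrightarrow> clinear_on V (\<lambda>x. f x * c :: complex)"
  by (simp add: clinear_on_def scaleC_complex_def algebra_simps)

lemma clinear_tensor_left [clinear_intros]: "clinear_on V f \<Longrightarrow> clinear_on V (\<lambda>x. f x \<otimes> v)"
  by (simp add: clinear_on_def tensor_pure_add_left tensor_pure_scale_left)

lemma clinear_tensor_right [clinear_intros]: "clinear_on V f \<Longrightarrow> clinear_on V (\<lambda>x. v \<otimes> f x)"
  by (simp add: clinear_on_def tensor_pure_add_right tensor_pure_scale_right)

definition cbilinear :: "('a::complex_vector \<Rightarrow> 'b::complex_vector \<Rightarrow> 'c::complex_vector) \<Rightarrow> bool"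
  where "cbilinear B \<longleftrightarrow> (\<forall>b. clinear (\<lambda>a. B a b)) \<and> (\<forall>a. clinear (\<lambda>b. B a b))"

lemma cbilinearI [clinear_intros]:
  "(\<And>b. clinear (\<lambda>a. B a b)) \<Longrightarrow> (\<And>a. clinear (\<lambda>b. B a b)) \<Longrightarrow> cbilinear B"
  by (simp add: cbilinear_def)

lemma cbilinear_left: "cbilinear B \<Longrightarrow> clinear f \<Longrightarrow> clinear (\<lambda>x. B (f x) b)"
  and cbilinear_right: "cbilinear B \<Longrightarrow> clinear f \<Longrightarrow> clinear (\<lambda>x. B a (f x))"
  by (auto simp: cbilinear_def clinear_on_def)


section \<open>Maps induced on tensor products\<close>

lemma cbilinear_balanced: "cbilinear B \<Longrightarrow> balanced_on UNIV UNIV B"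
  by (simp add: cbilinear_def balanced_on_def clinear_on_def)

lemma tensor_sum_exhaust: obtains xs where "x = tensor_sum xs"
  using tensor_space_UNIV by (force simp: tensor_space_def)

lemma tensor_lift_sum:
  "cbilinear B \<Longrightarrow> tensor_lift_UNIV B (tensor_sum xs) = (\<Sum>(a, b)\<leftarrow>xs. B a b)"
  by (rule tensor_lift_tensor_sum) (auto simp: cbilinear_balanced)

lemma tensor_sum_append: "tensor_sum xs + tensor_sum ys = tensor_sum (xs @ ys)"
  by (simp add: tensor_sum_def)

lemma tensor_sum_scale: "c *\<^sub>C tensor_sum xs = tensor_sum (map (\<lambda>(a, b). (c *\<^sub>C a, b)) xs)"
  by (induction xs) (auto simp: tensor_sum_def scaleC_add_right tensor_pure_scale_left)

lemma tensor_lift_pure: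
  assumes "cbilinear B" shows "tensor_lift_UNIV B (a \<otimes> b) = B a b"
  using tensor_lift_sum[OF assms, of "[(a, b)]"] by (simp add: tensor_sum_def)

lemma clinear_tensor_lift:
  assumes "cbilinear B"
  shows "clinear (tensor_lift_UNIV B)"
proof (rule clinear_onI)
  fix x y :: "('a, 'b) tensor" and c
  obtain xs ys where xs: "x = tensor_sum xs" and ys: "y = tensor_sum ys"
    by (meson tensor_sum_exhaust)
  show "tensor_lift_UNIV B (x + y) = tensor_lift_UNIV B x + tensor_lift_UNIV B y"
    by (simp add: xs ys tensor_sum_append tensor_lift_sum[OF assms])
  have "(\<Sum>(a, b)\<leftarrow>xs. B (c *\<^sub>C a) b) = c *\<^sub>C (\<Sum>(a, b)\<leftarrow>xs. B a b)"
    using assms by (induction xs) (auto simp: scaleC_add_right cbilinear_def clinear_on_def)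
  then show "tensor_lift_UNIV B (c *\<^sub>C x) = c *\<^sub>C tensor_lift_UNIV B x"
    by (simp add: xs tensor_sum_scale tensor_lift_sum[OF assms] comp_def case_prod_unfold)
qed

lemma clinear_tensor_lift_arg [clinear_intros]:
  assumes "clinear f" "cbilinear B"
  shows "clinear (\<lambda>x. tensor_lift_UNIV B (f x))"
  using clinear_on_compose[OF clinear_tensor_lift[OF assms(2)] assms(1)] by simp

text \<open>
  Needed to iterate lifts: it makes an inner lift linear in the outer variables.
\<close>

lemma clinear_tensor_lift_parameter:
  assumes "\<And>x. cbilinear (B x)" "\<And>a b. clinear (\<lambda>x. B x a b)"
  shows "clinear (\<lambda>x. tensor_lift_UNIV (B x) y)"
proof -
  obtain ys where ys: "y = tensor_sum ys"
    by (rule tensor_sum_exhaust)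
  have "clinear (\<lambda>x. \<Sum>(a, b)\<leftarrow>ys. B x a b)"
    using assms(2) by (induction ys) (auto simp: clinear_on_def scaleC_add_right)
  then show ?thesis
    by (simp add: ys tensor_lift_sum[OF assms(1)])
qed

lemma clinear_apply_tensor_lift:
  assumes "clinear h" "cbilinear B"
  shows "h (tensor_lift_UNIV B x) = tensor_lift_UNIV (\<lambda>a b. h (B a b)) x"
proof -
  obtain xs where xs: "x = tensor_sum xs"
    by (rule tensor_sum_exhaust)
  have "cbilinear (\<lambda>a b. h (B a b))"
    using assms by (simp add: cbilinear_def clinear_on_def)
  then show ?thesis
    by (simp add: xs tensor_lift_sum assms clinear_sum_list case_prod_unfold)
qed

text \<open>
  Mapping the two legs of a tensor by \<open>P\<close> and \<open>Q\<close> produces an explicit sum of tensors of elements of \<open>V\<close>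
  and \<open>W\<close>, from which the induced map can be read off. This replaces lifts from \<open>V \<otimes> W\<close> by lifts from the full
  tensor product, whose values are controlled without any reference to \<open>V\<close> and \<open>W\<close>.
\<close>

lemma tensor_lift_subspaces:
  assumes V: "complex_vector.subspace V" and W: "complex_vector.subspace W"
    and P: "clinear P" "\<And>a. P a \<in> V" and Q: "clinear Q" "\<And>b. Q b \<in> W"
    and B: "\<And>b. b \<in> W \<Longrightarrow> clinear_on V (\<lambda>a. B a b)" "\<And>a. a \<in> V \<Longrightarrow> clinear_on W (B a)"
  shows "tensor_lift V W B (tensor_lift_UNIV (\<lambda>a b. P a \<otimes> Q b) z)
    = tensor_lift_UNIV (\<lambda>a b. B (P a) (Q b)) z"
proof -
  obtain xs where xs: "z = tensor_sum xs"
    by (rule tensor_sum_exhaust)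
  let ?ys = "map (\<lambda>(a, b). (P a, Q b)) xs"
  have PQ: "cbilinear (\<lambda>a b. P a \<otimes> Q b)"
    by (intro clinear_intros P Q)
  have BPQ: "cbilinear (\<lambda>a b. B (P a) (Q b))"
    by (intro cbilinearI clinear_on_compose[OF B(1)] clinear_on_compose[OF B(2)] P Q)
  have "balanced_on V W B"
    using B by (simp add: balanced_on_def clinear_on_def)
  then have "tensor_lift V W B (tensor_sum ?ys) = (\<Sum>(a, b)\<leftarrow>?ys. B a b)"
    by (rule tensor_lift_tensor_sum[OF V W]) (use P Q in auto)
  moreover have "tensor_lift_UNIV (\<lambda>a b. P a \<otimes> Q b) z = tensor_sum ?ys"
    by (simp add: xs tensor_lift_sum[OF PQ]) (simp add: tensor_sum_def comp_def case_prod_unfold)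
  ultimately show ?thesis
    by (simp add: xs tensor_lift_sum[OF BPQ] comp_def case_prod_unfold)
qed


section \<open>Convolution and slice maps on a coalgebra\<close>

text \<open>
  Coassociativity is stated with the same associator \<open>tensor_assoc\<close> that the axioms of a Hopf
  \<open>*\<close>-algebra use.
\<close>

locale coalgebra =
  fixes \<Delta> :: "'a::complex_vector \<Rightarrow> ('a, 'a) tensor"
    and \<epsilon> :: "'a \<Rightarrow> complex"
  assumes comult_linear: "clinear \<Delta>"
    and coassoc:
      "tensor_assoc (tensor_lift_UNIV (\<lambda>a b. \<Delta> a \<otimes> b) (\<Delta> x)) = tensor_lift_UNIV (\<lambda>a b. a \<otimes> \<Delta> b) (\<Delta> x)"
    and counit_linear: "clinear \<epsilon>"
    and counit_left: "tensor_lift_UNIV (\<lambda>a b. \<epsilon> a *\<^sub>C b) (\<Delta> x) = x"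
    and counit_right: "tensor_lift_UNIV (\<lambda>a b. \<epsilon> b *\<^sub>C a) (\<Delta> x) = x"
begin

lemma clinear_comult [clinear_intros]: "clinear f \<Longrightarrow> clinear (\<lambda>x. \<Delta> (f x))"
  using clinear_on_compose[OF comult_linear] by simp

text \<open>
  Coassociativity in the form in which it is applied: a trilinear map takes the same value on the two
  iterated coproducts. In Sweedler notation both sides are \<open>\<Sum> M x\<^sub>1 x\<^sub>2 x\<^sub>3\<close>.
\<close>

lemma coassoc_trilinear:
  fixes M :: "'a \<Rightarrow> 'a \<Rightarrow> 'a \<Rightarrow> 'b::complex_vector"
  assumes M: "\<And>b c. clinear (\<lambda>a. M a b c)" "\<And>a c. clinear (\<lambda>b. M a b c)" "\<And>a b. clinear (M a b)"
  shows "tensor_lift_UNIV (\<lambda>a b. tensor_lift_UNIV (\<lambda>c d. M c d b) (\<Delta> a)) (\<Delta> x)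
    = tensor_lift_UNIV (\<lambda>a b. tensor_lift_UNIV (\<lambda>c d. M a c d) (\<Delta> b)) (\<Delta> x)"
proof -
  define h where "h = tensor_lift_UNIV (\<lambda>a. tensor_lift_UNIV (M a))"
  have bil: "cbilinear (\<lambda>a b. M a b c)" "cbilinear (M a)" for a c
    by (intro clinear_intros M)+
  have hbil: "cbilinear (\<lambda>a y. tensor_lift_UNIV (M a) y)"
    by (intro clinear_intros clinear_tensor_lift_parameter bil M)
  have h: "clinear h"
    unfolding h_def by (rule clinear_tensor_lift[OF hbil])
  have h_pure: "h (a \<otimes> b \<otimes> c) = M a b c" for a b c
    by (simp add: h_def tensor_lift_pure[OF hbil] tensor_lift_pure[OF bil(2)])
  have inner: "cbilinear (\<lambda>a b. a \<otimes> b \<otimes> c)" for c :: 'a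
    by (intro clinear_intros)
  have outer: "cbilinear (\<lambda>x c. tensor_lift_UNIV (\<lambda>a b. a \<otimes> b \<otimes> (c::'a)) (x :: ('a, 'a) tensor))"
    by (intro clinear_intros clinear_tensor_lift_parameter)
  have assoc: "clinear (tensor_assoc :: (('a, 'a) tensor, 'a) tensor \<Rightarrow> _)"
    unfolding tensor_assoc_def by (rule clinear_tensor_lift[OF outer])
  have "h (tensor_assoc (y \<otimes> b)) = tensor_lift_UNIV (\<lambda>c d. M c d b) y" for y b
    unfolding tensor_assoc_def tensor_lift_pure[OF outer]
    by (simp add: clinear_apply_tensor_lift[OF h inner] h_pure)
  moreover have "h (a \<otimes> y) = tensor_lift_UNIV (M a) y" for a y
    by (simp add: h_def tensor_lift_pure[OF hbil])
  moreover have "h (tensor_assoc (tensor_lift_UNIV (\<lambda>a b. \<Delta> a \<otimes> b) (\<Delta> x)))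
    = tensor_lift_UNIV (\<lambda>a b. h (tensor_assoc (\<Delta> a \<otimes> b))) (\<Delta> x)"
    by (subst clinear_apply_tensor_lift[OF assoc], intro clinear_intros,
        subst clinear_apply_tensor_lift[OF h], intro cbilinearI clinear_on_compose[OF assoc] clinear_intros, auto)
  moreover have "h (tensor_lift_UNIV (\<lambda>a b. a \<otimes> \<Delta> b) (\<Delta> x))
    = tensor_lift_UNIV (\<lambda>a b. h (a \<otimes> \<Delta> b)) (\<Delta> x)"
    by (rule clinear_apply_tensor_lift[OF h]) (intro clinear_intros)
  ultimately show ?thesis
    using coassoc[of x] by simp
qed

lemma clinear_E_left [clinear_intros]:
  assumes "clinear f" "clinear \<mu>" shows "clinear (\<lambda>x. E_left \<Delta> \<mu> (f x))"
  unfolding E_left_def by (intro clinear_intros assms)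

lemma clinear_E_right [clinear_intros]:
  assumes "clinear f" "clinear \<mu>" shows "clinear (\<lambda>x. E_right \<Delta> \<mu> (f x))"
  unfolding E_right_def by (intro clinear_intros assms)

lemma clinear_convolution [clinear_intros]:
  assumes "clinear \<mu>" "clinear \<nu>" shows "clinear (convolution \<Delta> \<mu> \<nu>)"
  unfolding convolution_def by (intro clinear_intros assms)

text \<open>
  The two ways of evaluating \<open>\<mu> \<otimes> \<nu>\<close> on \<open>\<Delta> x\<close> one factor at a time.
\<close>

lemma convolution_E_left:
  assumes "clinear \<mu>" "clinear \<nu>"
  shows "convolution \<Delta> \<mu> \<nu> x = \<nu> (E_left \<Delta> \<mu> x)"
  unfolding convolution_def E_left_def
  by (subst clinear_apply_tensor_lift)
    (intro clinear_intros assms | simp add: clinear_scale[OF assms(2)] scaleC_complex_def)+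

lemma convolution_E_right:
  assumes "clinear \<mu>" "clinear \<nu>"
  shows "convolution \<Delta> \<mu> \<nu> x = \<mu> (E_right \<Delta> \<nu> x)"
  unfolding convolution_def E_right_def
  by (subst clinear_apply_tensor_lift)
    (intro clinear_intros assms | simp add: clinear_scale[OF assms(1)] scaleC_complex_def mult.commute)+

lemma counit_E_left:
  assumes "clinear \<mu>" shows "\<epsilon> (E_left \<Delta> \<mu> x) = \<mu> x"
  using convolution_E_left[OF assms counit_linear] convolution_E_right[OF assms counit_linear]
  by (simp add: E_right_def counit_right)

text \<open>
  This says \<open>\<Delta> \<circ> L\<^sub>\<mu> = (L\<^sub>\<mu> \<otimes> id) \<circ> \<Delta>\<close>, tested against a bilinear map: on both sides the iterated
  coproduct of \<open>x\<close> has its first leg evaluated by \<open>\<mu>\<close>. The next two lemmas evaluate the last and the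
  middle leg in the same way.
\<close>

lemma tensor_lift_comult_E_left:
  assumes B: "cbilinear B" and \<mu>: "clinear \<mu>"
  shows "tensor_lift_UNIV B (\<Delta> (E_left \<Delta> \<mu> x)) = tensor_lift_UNIV (\<lambda>a b. B (E_left \<Delta> \<mu> a) b) (\<Delta> x)"
proof -
  have "tensor_lift_UNIV B (\<Delta> (E_left \<Delta> \<mu> x))
    = tensor_lift_UNIV (\<lambda>a b. \<mu> a *\<^sub>C tensor_lift_UNIV B (\<Delta> b)) (\<Delta> x)"
    unfolding E_left_def
    by (subst clinear_apply_tensor_lift[where h = "\<lambda>y. tensor_lift_UNIV B (\<Delta> y)"])
      (simp_all add: clinear_scale[OF comult_linear] clinear_scale[OF clinear_tensor_lift[OF B]],
        (intro clinear_intros B \<mu>)+)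
  also have "\<dots> = tensor_lift_UNIV (\<lambda>a b. tensor_lift_UNIV (\<lambda>c d. \<mu> a *\<^sub>C B c d) (\<Delta> b)) (\<Delta> x)"
    by (subst clinear_apply_tensor_lift[where h = "\<lambda>y. _ *\<^sub>C y"]) (intro clinear_intros B refl)+
  also have "\<dots> = tensor_lift_UNIV (\<lambda>a b. tensor_lift_UNIV (\<lambda>c d. \<mu> c *\<^sub>C B d b) (\<Delta> a)) (\<Delta> x)"
    by (rule coassoc_trilinear[symmetric])
      (intro clinear_intros \<mu> cbilinear_left[OF B] cbilinear_right[OF B])+
  also have "\<dots> = tensor_lift_UNIV (\<lambda>a b. B (E_left \<Delta> \<mu> a) b) (\<Delta> x)"
    unfolding E_left_def
    by (subst clinear_apply_tensor_lift[where h = "\<lambda>y. B y _"])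
      (intro clinear_intros \<mu> cbilinear_left[OF B] | simp add: clinear_scale[OF cbilinear_left[OF B clinear_ident]])+
  finally show ?thesis .
qed

lemma tensor_lift_comult_E_right:
  assumes B: "cbilinear B" and \<nu>: "clinear \<nu>"
  shows "tensor_lift_UNIV B (\<Delta> (E_right \<Delta> \<nu> x)) = tensor_lift_UNIV (\<lambda>a b. B a (E_right \<Delta> \<nu> b)) (\<Delta> x)"
proof -
  have "tensor_lift_UNIV B (\<Delta> (E_right \<Delta> \<nu> x))
    = tensor_lift_UNIV (\<lambda>a b. \<nu> b *\<^sub>C tensor_lift_UNIV B (\<Delta> a)) (\<Delta> x)"
    unfolding E_right_def
    by (subst clinear_apply_tensor_lift[where h = "\<lambda>y. tensor_lift_UNIV B (\<Delta> y)"])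
      (simp_all add: clinear_scale[OF comult_linear] clinear_scale[OF clinear_tensor_lift[OF B]],
        (intro clinear_intros B \<nu>)+)
  also have "\<dots> = tensor_lift_UNIV (\<lambda>a b. tensor_lift_UNIV (\<lambda>c d. \<nu> b *\<^sub>C B c d) (\<Delta> a)) (\<Delta> x)"
    by (subst clinear_apply_tensor_lift[where h = "\<lambda>y. _ *\<^sub>C y"]) (intro clinear_intros B refl)+
  also have "\<dots> = tensor_lift_UNIV (\<lambda>a b. tensor_lift_UNIV (\<lambda>c d. \<nu> d *\<^sub>C B a c) (\<Delta> b)) (\<Delta> x)"
    by (rule coassoc_trilinear)
      (intro clinear_intros \<nu> cbilinear_left[OF B] cbilinear_right[OF B])+
  also have "\<dots> = tensor_lift_UNIV (\<lambda>a b. B a (E_right \<Delta> \<nu> b)) (\<Delta> x)"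
    unfolding E_right_def
    by (subst clinear_apply_tensor_lift[where h = "\<lambda>y. B _ y"])
      (intro clinear_intros \<nu> cbilinear_right[OF B] | simp add: clinear_scale[OF cbilinear_right[OF B clinear_ident]])+
  finally show ?thesis .
qed

lemma tensor_lift_middle:
  assumes B: "cbilinear B" and \<mu>: "clinear \<mu>"
  shows "tensor_lift_UNIV (\<lambda>a b. B (E_right \<Delta> \<mu> a) b) (\<Delta> x) = tensor_lift_UNIV (\<lambda>a b. B a (E_left \<Delta> \<mu> b)) (\<Delta> x)"
proof -
  have "tensor_lift_UNIV (\<lambda>a b. B (E_right \<Delta> \<mu> a) b) (\<Delta> x)
    = tensor_lift_UNIV (\<lambda>a b. tensor_lift_UNIV (\<lambda>c d. \<mu> d *\<^sub>C B c b) (\<Delta> a)) (\<Delta> x)"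
    unfolding E_right_def
    by (subst clinear_apply_tensor_lift[where h = "\<lambda>y. B y _"])
      (intro clinear_intros \<mu> cbilinear_left[OF B] | simp add: clinear_scale[OF cbilinear_left[OF B clinear_ident]])+
  also have "\<dots> = tensor_lift_UNIV (\<lambda>a b. tensor_lift_UNIV (\<lambda>c d. \<mu> c *\<^sub>C B a d) (\<Delta> b)) (\<Delta> x)"
    by (rule coassoc_trilinear)
      (intro clinear_intros \<mu> cbilinear_left[OF B] cbilinear_right[OF B])+
  also have "\<dots> = tensor_lift_UNIV (\<lambda>a b. B a (E_left \<Delta> \<mu> b)) (\<Delta> x)"
    unfolding E_left_def
    by (subst clinear_apply_tensor_lift[where h = "\<lambda>y. B _ y"])
      (intro clinear_intros \<mu> cbilinear_right[OF B] | simp add: clinear_scale[OF cbilinear_right[OF B clinear_ident]])+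
  finally show ?thesis .
qed

lemma comult_E_left:
  assumes "clinear \<mu>"
  shows "\<Delta> (E_left \<Delta> \<mu> x) = tensor_lift_UNIV (\<lambda>a b. E_left \<Delta> \<mu> a \<otimes> b) (\<Delta> x)"
proof -
  have id: "tensor_lift_UNIV (\<lambda>a b. a \<otimes> b) y = y" for y :: "('a, 'a) tensor"
    by (rule tensor_sum_exhaust[of y], simp, subst tensor_lift_sum)
      (intro clinear_intros | simp add: tensor_sum_def)+
  show ?thesis
    using tensor_lift_comult_E_left[OF _ assms, of "\<lambda>a b. a \<otimes> b" x]
    by (simp add: id clinear_intros)
qed

text \<open>
  The order of composition is reversed, since the slice map that is applied first consumes the first
  leg of the iterated coproduct.
\<close>

lemma E_left_E_left:
  assumes "clinear \<mu>" "clinear \<nu>"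
  shows "E_left \<Delta> \<nu> (E_left \<Delta> \<mu> x) = E_left \<Delta> (convolution \<Delta> \<mu> \<nu>) x"
  unfolding E_left_def[of _ \<nu>] E_left_def[of _ "convolution \<Delta> \<mu> \<nu>"] convolution_E_left[OF assms]
  by (rule tensor_lift_comult_E_left) (intro clinear_intros assms)+

lemma E_right_E_right:
  assumes "clinear \<mu>" "clinear \<nu>"
  shows "E_right \<Delta> \<mu> (E_right \<Delta> \<nu> x) = E_right \<Delta> (convolution \<Delta> \<mu> \<nu>) x"
  unfolding E_right_def[of _ \<mu>] E_right_def[of _ "convolution \<Delta> \<mu> \<nu>"] convolution_E_right[OF assms]
  by (rule tensor_lift_comult_E_right) (intro clinear_intros assms)+

lemma E_left_E_right:
  assumes "clinear \<mu>" "clinear \<nu>"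
  shows "E_left \<Delta> \<mu> (E_right \<Delta> \<nu> x) = E_right \<Delta> \<nu> (E_left \<Delta> \<mu> x)"
proof -
  have lin: "clinear (E_right \<Delta> \<nu>)"
    by (intro clinear_E_right[of "\<lambda>x. x"] clinear_ident assms)
  have "E_left \<Delta> \<mu> (E_right \<Delta> \<nu> x) = tensor_lift_UNIV (\<lambda>a b. \<mu> a *\<^sub>C E_right \<Delta> \<nu> b) (\<Delta> x)"
    unfolding E_left_def by (rule tensor_lift_comult_E_right) (intro clinear_intros assms)+
  also have "\<dots> = E_right \<Delta> \<nu> (E_left \<Delta> \<mu> x)"
    unfolding E_left_def
    by (subst clinear_apply_tensor_lift[OF lin]) (intro clinear_intros assms | simp add: clinear_scale[OF lin])+
  finally show ?thesis .
qed

end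


section \<open>Idempotent functionals\<close>

locale coalgebra_idempotent = coalgebra \<Delta> \<epsilon>
  for \<Delta> :: "'a::complex_vector \<Rightarrow> ('a, 'a) tensor" and \<epsilon> :: "'a \<Rightarrow> complex" +
  fixes \<Phi> :: "'a \<Rightarrow> complex"
  assumes \<Phi>_linear: "clinear \<Phi>" and \<Phi>_idempotent: "convolution \<Delta> \<Phi> \<Phi> = \<Phi>"
begin

text \<open>
  For the Hopf algebra of a compact quantum group, \<open>V\<close> and \<open>W\<close> are the algebras of functions on the
  quotient and on the double coset space; \<open>E\<close> and \<open>E \<circ> F\<close> are the projections onto them.
\<close>

abbreviation "V \<equiv> O_left \<Delta> \<Phi>"
abbreviation "W \<equiv> O_bi \<Delta> \<Phi>"
abbreviation "E \<equiv> E_left \<Delta> \<Phi>"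
abbreviation "F \<equiv> E_right \<Delta> \<Phi>"

lemma clinear_E: "clinear E"
  and clinear_F: "clinear F"
  by (intro clinear_E_left[of "\<lambda>x. x"] clinear_E_right[of "\<lambda>x. x"] clinear_ident \<Phi>_linear)+

lemma E_E [simp]: "E (E x) = E x"
  and F_F [simp]: "F (F x) = F x"
  and E_F: "E (F x) = F (E x)"
  by (simp_all add: E_left_E_left E_right_E_right E_left_E_right \<Phi>_linear \<Phi>_idempotent)

lemma E_in_V [simp]: "E x \<in> V"
  and E_V: "x \<in> V \<Longrightarrow> E x = x"
  by (auto simp: O_left_def)

lemma EF_in_W [simp]: "E (F x) \<in> W"
proof -
  have "E (F x) \<in> range E"
    by (rule rangeI)
  moreover have "E (F x) \<in> range F"
    unfolding E_F by (rule rangeI)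
  ultimately show ?thesis
    by (simp add: O_bi_def O_left_def O_right_def)
qed

lemma E_W: "x \<in> W \<Longrightarrow> E x = x"
  and F_W: "x \<in> W \<Longrightarrow> F x = x"
  by (auto simp: O_bi_def O_right_def E_V)

lemma subspace_V: "complex_vector.subspace V"
  unfolding O_left_def by (rule clinear_range_subspace[OF clinear_E])

lemma subspace_W: "complex_vector.subspace W"
proof -
  have "complex_vector.subspace (range F)"
    by (rule clinear_range_subspace[OF clinear_F])
  then show ?thesis
    unfolding O_bi_def O_right_def by (rule complex_vector.subspace_inter[OF subspace_V])
qed

lemma clinear_E_compose: "clinear_on V f \<Longrightarrow> clinear (\<lambda>x. f (E x))"
  by (erule clinear_on_compose[OF _ clinear_E]) simp

lemma clinear_EF_compose: "clinear_on W f \<Longrightarrow> clinear (\<lambda>x. f (E (F x)))"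
  by (erule clinear_on_compose) (intro clinear_intros \<Phi>_linear | simp)+

text \<open>
  For \<open>x\<close> in \<open>V\<close> the identity \<open>\<Delta> x = (E \<otimes> id) (\<Delta> x)\<close> exhibits \<open>\<Delta> x\<close> as an element of \<open>V \<otimes> A\<close>. Hence each
  lift from \<open>V \<otimes> A\<close> along the coaction is a lift from \<open>A \<otimes> A\<close> with \<open>E\<close> inserted in the first leg.
\<close>

lemma tensor_lift_coaction:
  assumes x: "x \<in> V"
    and B: "\<And>b. clinear_on V (\<lambda>a. B a b)" "\<And>a. a \<in> V \<Longrightarrow> clinear (B a)"
  shows "tensor_lift V UNIV B (\<Delta> x) = tensor_lift_UNIV (\<lambda>a b. B (E a) b) (\<Delta> x)"
proof -
  have "\<Delta> x = tensor_lift_UNIV (\<lambda>a b. E a \<otimes> b) (\<Delta> x)"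
    using comult_E_left[OF \<Phi>_linear, of x] E_V[OF x] by simp
  then have "tensor_lift V UNIV B (\<Delta> x)
    = tensor_lift V UNIV B (tensor_lift_UNIV (\<lambda>a b. E a \<otimes> b) (\<Delta> x))"
    by simp
  also have "\<dots> = tensor_lift_UNIV (\<lambda>a b. B (E a) b) (\<Delta> x)"
    by (rule tensor_lift_subspaces[OF subspace_V complex_vector.subspace_UNIV clinear_E _ clinear_ident])
      (use B in auto)
  finally show ?thesis .
qed

lemma Phi_invariant_iff:
  assumes "clinear_on V f"
  shows "Phi_invariant \<Delta> \<Phi> f \<longleftrightarrow> (\<forall>x\<in>V. convolution \<Delta> (\<lambda>x. f (E x)) \<Phi> x = f x)"
proof -
  have "tensor_lift V UNIV (\<lambda>a b. f a * \<Phi> b) (\<Delta> x) = convolution \<Delta> (\<lambda>x. f (E x)) \<Phi> x"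
    if "x \<in> V" for x
    unfolding convolution_def
    by (rule tensor_lift_coaction[OF that]) (intro clinear_intros assms \<Phi>_linear)+
  then show ?thesis
    by (simp add: Phi_invariant_def)
qed

lemma convolution_left_eq:
  assumes "clinear_on V f" "clinear_on V g" "x \<in> V"
  shows "convolution_left \<Delta> \<Phi> f g x = convolution \<Delta> (\<lambda>x. f (E x)) (\<lambda>x. g (E x)) x"
  unfolding convolution_def convolution_left_def
  by (rule tensor_lift_coaction[OF assms(3)])
    (intro clinear_intros assms clinear_E_compose)+

text \<open>
  Slicing the middle leg by \<open>\<Phi>\<close> amounts to applying \<open>E\<close> to the second leg of \<open>\<Delta> x\<close>, or equally \<open>F\<close> to the
  first; as \<open>E\<close> is idempotent, both can be done at once. The remaining projections, \<open>E\<close> on the first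
  leg and \<open>F\<close> on the second, come from \<open>x = E x\<close> and \<open>x = F x\<close>.
\<close>

lemma comult_bi_eq:
  assumes x: "x \<in> W"
  shows "comult_bi \<Delta> \<Phi> x = tensor_lift_UNIV (\<lambda>a b. E (F a) \<otimes> E (F b)) (\<Delta> x)"
proof -
  have bil: "cbilinear (\<lambda>a y. a \<otimes> tensor_lift_UNIV (\<lambda>b c. \<Phi> b *\<^sub>C c) (y :: ('a, 'a) tensor) :: ('a, 'a) tensor)"
    by (intro clinear_intros \<Phi>_linear)
  \<comment> \<open>The outer legs may be projected because \<open>E x = x = F x\<close>.\<close>
  have step: "tensor_lift_UNIV B (\<Delta> x) = tensor_lift_UNIV (\<lambda>a b. B (E a) (F b)) (\<Delta> x)"
    if B: "cbilinear B" for B :: "'a \<Rightarrow> 'a \<Rightarrow> ('a, 'a) tensor"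
  proof -
    have "cbilinear (\<lambda>a b. B (E a) b)"
      by (intro clinear_intros cbilinear_left[OF B] cbilinear_right[OF B] \<Phi>_linear)
    then show ?thesis
      using tensor_lift_comult_E_left[OF B \<Phi>_linear, of x] E_W[OF x]
        tensor_lift_comult_E_right[OF _ \<Phi>_linear, of "\<lambda>a b. B (E a) b" x] F_W[OF x] by simp
  qed
  \<comment> \<open>Writing \<open>E b\<close> as \<open>E (E b)\<close> leaves one copy of \<open>E\<close> after the other has become \<open>F\<close> on the first leg.\<close>
  have "comult_bi \<Delta> \<Phi> x = tensor_lift_UNIV (\<lambda>a b. a \<otimes> E (E b)) (\<Delta> x)"
    unfolding comult_bi_def
    by (subst clinear_apply_tensor_lift[OF clinear_tensor_lift[OF bil]])
      (intro clinear_intros | simp add: tensor_lift_pure[OF bil] E_left_def[symmetric])+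
  also have "\<dots> = tensor_lift_UNIV (\<lambda>a b. F a \<otimes> E b) (\<Delta> x)"
    by (rule tensor_lift_middle[symmetric]) (intro clinear_intros \<Phi>_linear)+
  also have "\<dots> = tensor_lift_UNIV (\<lambda>a b. F (E a) \<otimes> E (F b)) (\<Delta> x)"
    by (rule step) (intro clinear_intros \<Phi>_linear)
  finally show ?thesis by (simp add: E_F)
qed

lemma convolution_bi_eq:
  assumes "clinear_on W f" "clinear_on W g" "x \<in> W"
  shows "convolution_bi \<Delta> \<Phi> f g x
    = convolution \<Delta> (\<lambda>x. f (E (F x))) (\<lambda>x. g (E (F x))) x"
  unfolding convolution_bi_def convolution_def comult_bi_eq[OF assms(3)]
  by (rule tensor_lift_subspaces[OF subspace_W subspace_W])
    (intro clinear_intros assms \<Phi>_linear EF_in_W)+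

lemma convolution_\<Phi>_left: "clinear \<mu> \<Longrightarrow> convolution \<Delta> \<Phi> \<mu> = (\<lambda>x. \<mu> (E x))"
  and convolution_\<Phi>_right: "clinear \<mu> \<Longrightarrow> convolution \<Delta> \<mu> \<Phi> = (\<lambda>x. \<mu> (F x))"
  by (simp_all add: fun_eq_iff convolution_E_left[OF \<Phi>_linear] convolution_E_right[OF _ \<Phi>_linear])

lemma Phi_bi_invariant_iff:
  assumes "clinear \<mu>"
  shows "Phi_bi_invariant \<Delta> \<Phi> \<mu> \<longleftrightarrow> (\<forall>x. \<mu> (E x) = \<mu> x) \<and> (\<forall>x. \<mu> (F x) = \<mu> x)"
  by (auto simp: Phi_bi_invariant_def convolution_\<Phi>_left convolution_\<Phi>_right assms fun_eq_iff)

text \<open>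
  Bi-invariance passes to convolution products: the left factor provides invariance under \<open>E\<close>, the
  right factor invariance under \<open>F\<close>. This extends the semigroup law of the extended functionals from
  \<open>V\<close> or \<open>W\<close> to the whole algebra.
\<close>

lemma convolution_E:
  assumes "clinear \<mu>" "clinear \<nu>" "\<And>x. \<mu> (E x) = \<mu> x"
  shows "convolution \<Delta> \<mu> \<nu> (E x) = convolution \<Delta> \<mu> \<nu> x"
proof -
  have "convolution \<Delta> \<mu> \<nu> (E x) = \<mu> (E (E_right \<Delta> \<nu> x))"
    by (simp only: convolution_E_right[OF assms(1,2)] E_left_E_right[OF \<Phi>_linear assms(2)])
  then show ?thesis
    by (simp only: assms(3) convolution_E_right[OF assms(1,2)])
qed

lemma convolution_F:
  assumes "clinear \<mu>" "clinear \<nu>" "\<And>x. \<nu> (F x) = \<nu> x"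
  shows "convolution \<Delta> \<mu> \<nu> (F x) = convolution \<Delta> \<mu> \<nu> x"
proof -
  have "convolution \<Delta> \<mu> \<nu> (F x) = \<nu> (F (E_left \<Delta> \<mu> x))"
    by (simp only: convolution_E_left[OF assms(1,2)] E_left_E_right[OF assms(1) \<Phi>_linear])
  then show ?thesis
    by (simp only: assms(3) convolution_E_left[OF assms(1,2)])
qed

text \<open>
  Since \<open>E\<close> and \<open>F\<close> commute, \<open>f (E (F x)) = f x\<close> for all \<open>x\<close> in \<open>V\<close> means \<open>f \<circ> E \<circ> F = f \<circ> E\<close>, which is
  invariance of \<open>f \<circ> E\<close> under \<open>F\<close>; its invariance under \<open>E\<close> is automatic.
\<close>

lemma Phi_invariant_iff_bi_invariant:
  assumes f: "clinear_on V f"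
  shows "Phi_invariant \<Delta> \<Phi> f \<longleftrightarrow> Phi_bi_invariant \<Delta> \<Phi> (\<lambda>x. f (E x))"
proof -
  have "Phi_invariant \<Delta> \<Phi> f \<longleftrightarrow> (\<forall>x\<in>V. f (E (F x)) = f x)"
    by (simp add: Phi_invariant_iff[OF f] convolution_\<Phi>_right[OF clinear_E_compose[OF f]])
  also have "\<dots> \<longleftrightarrow> (\<forall>x. f (E (F (E x))) = f (E x))"
    unfolding O_left_def by blast
  also have "\<dots> \<longleftrightarrow> (\<forall>x. f (E (F x)) = f (E x))"
    by (simp only: E_F[symmetric] E_E)
  finally show ?thesis
    by (simp add: Phi_bi_invariant_iff[OF clinear_E_compose[OF f]])
qed

end


section \<open>Semigroups\<close>

text \<open>
  The functionals that correspond to each other are, pointwise in \<open>t\<close>, restrictions of each other or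
  compositions with a fixed projection. The equation between \<open>g\<close> and \<open>f\<close>
  is required just for \<open>t \<ge> 0\<close>, because the families are undefined for negative \<open>t\<close>.
\<close>

lemma weakly_continuous_pullback:
  assumes "weakly_continuous Y f" "\<And>x. x \<in> X \<Longrightarrow> h x \<in> Y"
    and "\<And>t x. t \<ge> 0 \<Longrightarrow> x \<in> X \<Longrightarrow> g t x = f t (h x)"
  shows "weakly_continuous X g"
  unfolding weakly_continuous_def
proof
  fix x assume x: "x \<in> X"
  then have "((\<lambda>t. f t (h x)) \<longlongrightarrow> f 0 (h x)) (at_right 0)"
    using assms(1,2) by (simp add: weakly_continuous_def)
  moreover have "\<forall>\<^sub>F t in at_right 0. f t (h x) = g t x"
    using assms(3) x by (auto simp: eventually_at_filter)
  ultimately show "((\<lambda>t. g t x) \<longlongrightarrow> g 0 x) (at_right 0)"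
    using assms(3)[of 0] x by (simp add: Lim_transform_eventually)
qed

lemma convolution_semigroupsI:
  assumes "\<And>t. t \<ge> 0 \<Longrightarrow> f t \<in> extensional X" "\<And>t. t \<ge> 0 \<Longrightarrow> clinear_on X (f t)"
    and "weakly_continuous X f"
    and "\<And>s t x. s \<ge> 0 \<Longrightarrow> t \<ge> 0 \<Longrightarrow> x \<in> X \<Longrightarrow> conv (f s) (f t) x = f (s + t) x"
  shows "(\<lambda>t\<in>{0..}. f t) \<in> convolution_semigroups X conv"
proof -
  have "weakly_continuous X (\<lambda>t\<in>{0..}. f t)"
    by (rule weakly_continuous_pullback[OF assms(3), of X "\<lambda>x. x"]) auto
  then show ?thesis
    using assms by (auto simp: convolution_semigroups_def linear_functionals_def)
qed

lemma convolution_semigroupsD: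
  assumes "f \<in> convolution_semigroups X conv"
  shows "f \<in> extensional {0..}"
    and "t \<ge> 0 \<Longrightarrow> f t \<in> extensional X"
    and "t \<ge> 0 \<Longrightarrow> clinear_on X (f t)"
    and "weakly_continuous X f"
    and "s \<ge> 0 \<Longrightarrow> t \<ge> 0 \<Longrightarrow> x \<in> X \<Longrightarrow> conv (f s) (f t) x = f (s + t) x"
  using assms
  by (auto simp: convolution_semigroups_def linear_functionals_def PiE_def Pi_def)

lemma one_to_one_correspondenceI:
  assumes "\<And>x. x \<in> X \<Longrightarrow> F x \<in> Y" "\<And>y. y \<in> Y \<Longrightarrow> G y \<in> X"
    and "\<And>x. x \<in> X \<Longrightarrow> G (F x) = x" "\<And>y. y \<in> Y \<Longrightarrow> F (G y) = y"
  shows "one_to_one_correspondence X Y F G"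
  unfolding one_to_one_correspondence_def
  using assms by (auto intro!: bij_betw_byWitness[of X G F Y] bij_betw_byWitness[of Y F G X])


section \<open>The correspondences\<close>

context coalgebra_idempotent
begin

lemma bi_invariant_semigroupsD:
  assumes "\<mu> \<in> bi_invariant_semigroups \<Delta> \<Phi>" "t \<ge> 0"
  shows "clinear (\<mu> t)" "\<mu> t (E x) = \<mu> t x" "\<mu> t (F x) = \<mu> t x"
  using assms convolution_semigroupsD(3)[of \<mu> UNIV "convolution \<Delta>" t]
  by (auto simp: bi_invariant_semigroups_def Phi_bi_invariant_iff)

text \<open>
  The semigroup law holds on \<open>V\<close> by \<open>convolution_left_eq\<close>; both sides are unchanged when \<open>x\<close> is
  replaced by \<open>E x\<close>.
\<close>

lemma invariant_extension_semigroup: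
  assumes "l \<in> invariant_semigroups \<Delta> \<Phi>"
  shows "(\<lambda>t\<in>{0..}. \<lambda>x. l t (E x)) \<in> bi_invariant_semigroups \<Delta> \<Phi>"
proof -
  from assms have sg: "l \<in> convolution_semigroups V (convolution_left \<Delta> \<Phi>)"
    and inv: "t \<ge> 0 \<Longrightarrow> Phi_invariant \<Delta> \<Phi> (l t)" for t
    by (auto simp: invariant_semigroups_def)
  note l = convolution_semigroupsD[OF sg]
  have "(\<lambda>t\<in>{0..}. \<lambda>x. l t (E x)) \<in> convolution_semigroups UNIV (convolution \<Delta>)"
  proof (rule convolution_semigroupsI)
    show "weakly_continuous UNIV (\<lambda>t x. l t (E x))"
      by (rule weakly_continuous_pullback[OF l(4)]) auto
  next
    fix s t :: real and x assume st: "s \<ge> 0" "t \<ge> 0"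
    have "convolution \<Delta> (\<lambda>x. l s (E x)) (\<lambda>x. l t (E x)) x
      = convolution \<Delta> (\<lambda>x. l s (E x)) (\<lambda>x. l t (E x)) (E x)"
      by (rule convolution_E[symmetric]) (simp_all add: st l(3) clinear_E_compose)
    also have "\<dots> = convolution_left \<Delta> \<Phi> (l s) (l t) (E x)"
      by (rule convolution_left_eq[symmetric]) (simp_all add: st l(3))
    finally show "convolution \<Delta> (\<lambda>x. l s (E x)) (\<lambda>x. l t (E x)) x = l (s + t) (E x)"
      by (simp add: l(5) st)
  qed (simp_all add: l(3) clinear_E_compose)
  then show ?thesis
    using inv l(3) by (simp add: bi_invariant_semigroups_def Phi_invariant_iff_bi_invariant)
qed

lemma bi_invariant_restriction_semigroup:
  assumes "\<mu> \<in> bi_invariant_semigroups \<Delta> \<Phi>"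
  shows "(\<lambda>t\<in>{0..}. restrict (\<mu> t) V) \<in> invariant_semigroups \<Delta> \<Phi>"
proof -
  from assms have sg: "\<mu> \<in> convolution_semigroups UNIV (convolution \<Delta>)"
    and inv: "t \<ge> 0 \<Longrightarrow> Phi_bi_invariant \<Delta> \<Phi> (\<mu> t)" for t
    by (auto simp: bi_invariant_semigroups_def)
  note \<mu> = convolution_semigroupsD[OF sg] and \<mu>_inv = bi_invariant_semigroupsD[OF assms]
  have lin: "clinear_on V (restrict (\<mu> t) V)" if "t \<ge> 0" for t
    using \<mu>(3)[OF that] complex_vector.subspace_add[OF subspace_V] complex_vector.subspace_scale[OF subspace_V]
    by (simp add: clinear_on_def)
  have "(\<lambda>t\<in>{0..}. restrict (\<mu> t) V) \<in> convolution_semigroups V (convolution_left \<Delta> \<Phi>)"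
  proof (rule convolution_semigroupsI)
    show "weakly_continuous V (\<lambda>t. restrict (\<mu> t) V)"
      by (rule weakly_continuous_pullback[OF \<mu>(4), of _ "\<lambda>x. x"]) auto
  next
    fix s t :: real and x assume st: "s \<ge> 0" "t \<ge> 0" and x: "x \<in> V"
    show "convolution_left \<Delta> \<Phi> (restrict (\<mu> s) V) (restrict (\<mu> t) V) x = restrict (\<mu> (s + t)) V x"
      using st x by (simp add: convolution_left_eq lin \<mu>_inv \<mu>(5))
  qed (simp_all add: lin)
  then show ?thesis
    using inv by (simp add: invariant_semigroups_def Phi_invariant_iff_bi_invariant lin \<mu>_inv)
qed

lemma bi_invariant_restriction_double_coset:
  assumes "\<mu> \<in> bi_invariant_semigroups \<Delta> \<Phi>"
  shows "(\<lambda>t\<in>{0..}. restrict (\<mu> t) W) \<in> double_coset_semigroups \<Delta> \<Phi>"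
proof -
  from assms have sg: "\<mu> \<in> convolution_semigroups UNIV (convolution \<Delta>)"
    by (auto simp: bi_invariant_semigroups_def)
  note \<mu> = convolution_semigroupsD[OF sg] and \<mu>_inv = bi_invariant_semigroupsD[OF assms]
  have lin: "clinear_on W (restrict (\<mu> t) W)" if "t \<ge> 0" for t
    using \<mu>(3)[OF that] complex_vector.subspace_add[OF subspace_W] complex_vector.subspace_scale[OF subspace_W]
    by (simp add: clinear_on_def)
  show ?thesis
    unfolding double_coset_semigroups_def
  proof (rule convolution_semigroupsI)
    show "weakly_continuous W (\<lambda>t. restrict (\<mu> t) W)"
      by (rule weakly_continuous_pullback[OF \<mu>(4), of _ "\<lambda>x. x"]) auto
  next
    fix s t :: real and x assume st: "s \<ge> 0" "t \<ge> 0" and x: "x \<in> W"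
    show "convolution_bi \<Delta> \<Phi> (restrict (\<mu> s) W) (restrict (\<mu> t) W) x = restrict (\<mu> (s + t)) W x"
      using st x by (simp add: convolution_bi_eq lin \<mu>_inv \<mu>(5))
  qed (simp_all add: lin)
qed

text \<open>
  As for the extension from \<open>V\<close>, but now both sides of the semigroup law are unchanged under \<open>E\<close> and
  under \<open>F\<close>, so it is enough to verify it on \<open>W\<close>.
\<close>

lemma double_coset_extension_semigroup:
  assumes "f \<in> double_coset_semigroups \<Delta> \<Phi>"
  shows "(\<lambda>t\<in>{0..}. \<lambda>x. f t (E (F x))) \<in> bi_invariant_semigroups \<Delta> \<Phi>"
proof -
  note f = convolution_semigroupsD[OF assms[unfolded double_coset_semigroups_def]]
  let ?m = "\<lambda>t x. f t (E (F x))"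
  have lin: "clinear (?m t)" if "t \<ge> 0" for t
    by (rule clinear_EF_compose[OF f(3)[OF that]])
  have mE: "?m t (E x) = ?m t x" for t x
    by (simp add: E_F[symmetric])
  have "(\<lambda>t\<in>{0..}. ?m t) \<in> convolution_semigroups UNIV (convolution \<Delta>)"
  proof (rule convolution_semigroupsI)
    show "weakly_continuous UNIV ?m"
      by (rule weakly_continuous_pullback[OF f(4)]) auto
  next
    fix s t :: real and x assume st: "s \<ge> 0" "t \<ge> 0"
    have "convolution \<Delta> (?m s) (?m t) x = convolution \<Delta> (?m s) (?m t) (E (F x))"
      using convolution_E[of "?m s" "?m t"] convolution_F[of "?m s" "?m t"]
      by (simp add: lin st mE)
    also have "\<dots> = convolution_bi \<Delta> \<Phi> (f s) (f t) (E (F x))"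
      by (rule convolution_bi_eq[symmetric]) (simp_all add: st f(3))
    finally show "convolution \<Delta> (?m s) (?m t) x = ?m (s + t) x"
      by (simp add: f(5) st)
  qed (simp_all add: lin)
  then show ?thesis
    by (simp add: bi_invariant_semigroups_def Phi_bi_invariant_iff lin mE)
qed

lemma invariant_bi_invariant_correspondence:
  "one_to_one_correspondence (invariant_semigroups \<Delta> \<Phi>) (bi_invariant_semigroups \<Delta> \<Phi>)
    (\<lambda>l. \<lambda>t\<in>{0..}. \<lambda>x. l t (E x)) (\<lambda>\<mu>. \<lambda>t\<in>{0..}. restrict (\<mu> t) V)"
proof (rule one_to_one_correspondenceI)
  fix l assume "l \<in> invariant_semigroups \<Delta> \<Phi>"
  then have "l \<in> convolution_semigroups V (convolution_left \<Delta> \<Phi>)"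
    by (simp add: invariant_semigroups_def)
  note l = convolution_semigroupsD(1,2)[OF this]
  have "restrict (\<lambda>x. l t (E x)) V = l t" if "t \<ge> 0" for t
    by (rule extensionalityI[of _ V]) (simp_all add: l that E_V)
  then show "(\<lambda>t\<in>{0..}. restrict ((\<lambda>t\<in>{0..}. \<lambda>x. l t (E x)) t) V) = l"
    by (intro extensionalityI[of _ "{0..}"]) (simp_all add: l)
next
  fix \<mu> assume mem: "\<mu> \<in> bi_invariant_semigroups \<Delta> \<Phi>"
  then have "\<mu> \<in> extensional {0..}"
    using convolution_semigroupsD(1) by (auto simp: bi_invariant_semigroups_def)
  then show "(\<lambda>t\<in>{0..}. \<lambda>x. (\<lambda>t\<in>{0..}. restrict (\<mu> t) V) t (E x)) = \<mu>"
    by (intro extensionalityI[of _ "{0..}"]) (simp_all add: bi_invariant_semigroupsD[OF mem])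
qed (fact invariant_extension_semigroup bi_invariant_restriction_semigroup)+

lemma bi_invariant_double_coset_correspondence:
  "one_to_one_correspondence (bi_invariant_semigroups \<Delta> \<Phi>) (double_coset_semigroups \<Delta> \<Phi>)
    (\<lambda>\<mu>. \<lambda>t\<in>{0..}. restrict (\<mu> t) W) (\<lambda>f. \<lambda>t\<in>{0..}. \<lambda>x. f t (E (F x)))"
proof (rule one_to_one_correspondenceI)
  fix f assume "f \<in> double_coset_semigroups \<Delta> \<Phi>"
  then have "f \<in> convolution_semigroups W (convolution_bi \<Delta> \<Phi>)"
    by (simp add: double_coset_semigroups_def)
  note f = convolution_semigroupsD(1,2)[OF this]
  have "restrict (\<lambda>x. f t (E (F x))) W = f t" if "t \<ge> 0" for t
    by (rule extensionalityI[of _ W]) (simp_all add: f that E_W F_W)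
  then show "(\<lambda>t\<in>{0..}. restrict ((\<lambda>t\<in>{0..}. \<lambda>x. f t (E (F x))) t) W) = f"
    by (intro extensionalityI[of _ "{0..}"]) (simp_all add: f)
next
  fix \<mu> assume mem: "\<mu> \<in> bi_invariant_semigroups \<Delta> \<Phi>"
  then have "\<mu> \<in> extensional {0..}"
    using convolution_semigroupsD(1) by (auto simp: bi_invariant_semigroups_def)
  then show "(\<lambda>t\<in>{0..}. \<lambda>x. (\<lambda>t\<in>{0..}. restrict (\<mu> t) W) t (E (F x))) = \<mu>"
    by (intro extensionalityI[of _ "{0..}"]) (simp_all add: bi_invariant_semigroupsD[OF mem])
qed (fact bi_invariant_restriction_double_coset double_coset_extension_semigroup)+

text \<open>
  Apply \<open>\<epsilon> \<otimes> id\<close> to \<open>\<Delta> (T x) = (T \<otimes> id) (\<Delta> x)\<close>.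
\<close>

lemma G_invariant_eq_slice:
  assumes T: "T \<in> linear_operators V" "G_invariant \<Delta> \<Phi> T" and x: "x \<in> V"
  shows "T x = E_left \<Delta> (\<lambda>x. \<epsilon> (T (E x))) x"
proof -
  have lin: "clinear_on V T"
    using T(1) by (simp add: linear_operators_def)
  have TE: "clinear (\<lambda>x. T (E x))"
    by (rule clinear_E_compose[OF lin])
  have bil: "cbilinear (\<lambda>a b. \<epsilon> a *\<^sub>C b)" for b :: 'a
    by (intro clinear_intros counit_linear)
  have "\<Delta> (T x) = tensor_lift_UNIV (\<lambda>a b. T (E a) \<otimes> b) (\<Delta> x)"
    using T(2) x tensor_lift_coaction[OF x, of "\<lambda>a b. T a \<otimes> b"]
    by (simp add: G_invariant_def lin clinear_intros)
  then have "T x = tensor_lift_UNIV (\<lambda>a b. \<epsilon> a *\<^sub>C b) (tensor_lift_UNIV (\<lambda>a b. T (E a) \<otimes> b) (\<Delta> x))"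
    using counit_left[of "T x"] by simp
  also have "\<dots> = tensor_lift_UNIV (\<lambda>a b. \<epsilon> (T (E a)) *\<^sub>C b) (\<Delta> x)"
    by (subst clinear_apply_tensor_lift[OF clinear_tensor_lift[OF bil]])
      (intro clinear_intros TE | simp add: tensor_lift_pure[OF bil])+
  finally show ?thesis
    by (simp add: E_left_def)
qed

text \<open>
  The projection of the second leg can be pulled out and then dropped: with \<open>\<mu> = f \<circ> E\<close> the left-hand
  side is \<open>E (L\<^sub>\<mu> x)\<close>, which is the slice of \<open>x\<close> by \<open>\<mu> \<star> \<Phi> = \<mu>\<close>.
\<close>

lemma operator_of_functional:
  assumes f: "clinear_on V f" "Phi_invariant \<Delta> \<Phi> f" and x: "x \<in> V"
  shows "tensor_lift V UNIV (\<lambda>a b. f a *\<^sub>C E b) (\<Delta> x) = E_left \<Delta> (\<lambda>x. f (E x)) x"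
proof -
  let ?m = "\<lambda>x. f (E x)"
  have m: "clinear ?m"
    by (rule clinear_E_compose[OF f(1)])
  have "Phi_bi_invariant \<Delta> \<Phi> ?m"
    using f by (simp add: Phi_invariant_iff_bi_invariant)
  then have conv: "convolution \<Delta> ?m \<Phi> = ?m"
    by (simp add: Phi_bi_invariant_def)
  have "tensor_lift V UNIV (\<lambda>a b. f a *\<^sub>C E b) (\<Delta> x) = tensor_lift_UNIV (\<lambda>a b. ?m a *\<^sub>C E b) (\<Delta> x)"
    by (rule tensor_lift_coaction[OF x]) (intro clinear_intros f \<Phi>_linear)+
  also have "\<dots> = E (E_left \<Delta> ?m x)"
    unfolding E_left_def[of _ ?m]
    by (subst clinear_apply_tensor_lift[OF clinear_E]) (intro clinear_intros m | simp add: clinear_scale[OF clinear_E])+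
  also have "\<dots> = E_left \<Delta> ?m x"
    by (simp add: E_left_E_left[OF m \<Phi>_linear] conv)
  finally show ?thesis .
qed

text \<open>
  Invariance of \<open>\<epsilon> \<circ> T\<close> rests on this: evaluating the second leg by \<open>\<Phi>\<close> gives \<open>\<Phi> (T x)\<close>, and \<open>T x\<close> lies
  in \<open>V\<close>.
\<close>

lemma \<Phi>_V: "x \<in> V \<Longrightarrow> \<Phi> x = \<epsilon> x"
  using counit_E_left[OF \<Phi>_linear, of x] by (simp add: E_V)

text \<open>
  Put \<open>\<mu>\<^sub>t = \<epsilon> \<circ> T\<^sub>t \<circ> E\<close>, so that \<open>T\<^sub>t\<close> is the slice map of \<open>\<mu>\<^sub>t\<close>. Then \<open>\<mu>\<^sub>s \<star> \<mu>\<^sub>t = \<mu>\<^sub>t \<circ> L\<^sub>\<mu>\<^sub>s\<close> is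
  \<open>\<epsilon> \<circ> T\<^sub>t \<circ> T\<^sub>s\<close> on \<open>V\<close>, and \<open>T\<^sub>t \<circ> T\<^sub>s = T\<^sub>s\<^sub>+\<^sub>t\<close> as \<open>s + t = t + s\<close>.
\<close>

lemma operator_to_functional_semigroup:
  assumes "T \<in> invariant_operator_semigroups \<Delta> \<epsilon> \<Phi>"
  shows "(\<lambda>t\<in>{0..}. \<lambda>x\<in>V. \<epsilon> (T t x)) \<in> invariant_semigroups \<Delta> \<Phi>"
proof -
  have op: "T t \<in> linear_operators V" and G: "G_invariant \<Delta> \<Phi> (T t)" if "t \<ge> 0" for t
    using assms that by (auto simp: invariant_operator_semigroups_def PiE_def Pi_def)
  have TV: "T t x \<in> V" if "t \<ge> 0" "x \<in> V" for t x
    using op[OF that(1)] that(2) by (auto simp: linear_operators_def)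
  have sg: "T (s + t) x = T s (T t x)" if "s \<ge> 0" "t \<ge> 0" "x \<in> V" for s t x
    using assms that by (simp add: invariant_operator_semigroups_def)
  let ?l = "\<lambda>t. \<lambda>x\<in>V. \<epsilon> (T t x)"
  have lin: "clinear_on V (?l t)" if "t \<ge> 0" for t
    using op[OF that] complex_vector.subspace_add[OF subspace_V] complex_vector.subspace_scale[OF subspace_V]
    by (simp add: clinear_on_def linear_operators_def clinear_add[OF counit_linear] clinear_scale[OF counit_linear])
  have slice: "E_left \<Delta> (\<lambda>x. ?l t (E x)) x = T t x" if "t \<ge> 0" "x \<in> V" for t x
    using G_invariant_eq_slice[OF op[OF that(1)] G[OF that(1)] that(2)] by simp
  have "(\<lambda>t\<in>{0..}. ?l t) \<in> convolution_semigroups V (convolution_left \<Delta> \<Phi>)"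
  proof (rule convolution_semigroupsI)
    have "weakly_continuous V (\<lambda>t x. \<epsilon> (T t x))"
      using assms by (simp add: invariant_operator_semigroups_def)
    then show "weakly_continuous V ?l"
      by (rule weakly_continuous_pullback[where h = "\<lambda>x. x"]) auto
  next
    fix s t :: real and x assume st: "s \<ge> 0" "t \<ge> 0" and x: "x \<in> V"
    have "convolution_left \<Delta> \<Phi> (?l s) (?l t) x
      = ?l t (E (E_left \<Delta> (\<lambda>x. ?l s (E x)) x))"
      by (simp only: convolution_left_eq[OF lin[OF st(1)] lin[OF st(2)] x]
          convolution_E_left[OF clinear_E_compose[OF lin[OF st(1)]] clinear_E_compose[OF lin[OF st(2)]]])
    also have "\<dots> = \<epsilon> (T t (T s x))"
      using st x by (simp only: slice) (simp add: TV E_V)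
    finally show "convolution_left \<Delta> \<Phi> (?l s) (?l t) x = ?l (s + t) x"
      using st x by (simp add: sg[symmetric] add.commute)
  qed (simp_all add: lin)
  moreover have "Phi_invariant \<Delta> \<Phi> (?l t)" if t: "t \<ge> 0" for t
    unfolding Phi_invariant_iff[OF lin[OF t]]
  proof
    fix x assume x: "x \<in> V"
    have "convolution \<Delta> (\<lambda>x. ?l t (E x)) \<Phi> x = \<Phi> (T t x)"
      by (simp only: convolution_E_left[OF clinear_E_compose[OF lin[OF t]] \<Phi>_linear] slice[OF t x])
    then show "convolution \<Delta> (\<lambda>x. ?l t (E x)) \<Phi> x = ?l t x"
      using x t by (simp add: \<Phi>_V TV)
  qed
  ultimately show ?thesis
    by (simp add: invariant_semigroups_def)
qed

text \<open>
  Each operator is the slice map of the bi-invariant functional \<open>\<mu>\<^sub>t = l\<^sub>t \<circ> E\<close>. Its values lie in \<open>V\<close>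
  because \<open>\<mu>\<^sub>t \<star> \<Phi> = \<mu>\<^sub>t\<close>, it is invariant because slice maps commute with the coaction, and the
  semigroup law is that of the \<open>\<mu>\<^sub>t\<close>. The second part shows that the functional is recovered.
\<close>

lemma functional_to_operator_semigroup:
  assumes "l \<in> invariant_semigroups \<Delta> \<Phi>"
  shows "(\<lambda>t\<in>{0..}. \<lambda>x\<in>V. tensor_lift V UNIV (\<lambda>a b. l t a *\<^sub>C E b) (\<Delta> x))
      \<in> invariant_operator_semigroups \<Delta> \<epsilon> \<Phi>"
    and "t \<ge> 0 \<Longrightarrow> x \<in> V
      \<Longrightarrow> \<epsilon> (tensor_lift V UNIV (\<lambda>a b. l t a *\<^sub>C E b) (\<Delta> x)) = l t x"
proof -
  have lV: "l \<in> convolution_semigroups V (convolution_left \<Delta> \<Phi>)"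
    and inv: "t \<ge> 0 \<Longrightarrow> Phi_invariant \<Delta> \<Phi> (l t)" for t
    using assms by (auto simp: invariant_semigroups_def)
  note l = convolution_semigroupsD[OF lV]
  define U where "U t = (\<lambda>x\<in>V. tensor_lift V UNIV (\<lambda>a b. l t a *\<^sub>C E b) (\<Delta> x))" for t
  let ?m = "\<lambda>t x. l t (E x)"
  have m_lin: "clinear (?m t)" if "t \<ge> 0" for t
    by (rule clinear_E_compose[OF l(3)[OF that]])
  have U: "U t x = E_left \<Delta> (?m t) x" if "t \<ge> 0" "x \<in> V" for t x
    using that by (simp add: U_def operator_of_functional l(3) inv)
  have bi: "(\<lambda>t\<in>{0..}. ?m t) \<in> bi_invariant_semigroups \<Delta> \<Phi>"
    by (rule invariant_extension_semigroup[OF assms])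
  then have bi': "(\<lambda>t\<in>{0..}. ?m t) \<in> convolution_semigroups UNIV (convolution \<Delta>)"
    by (simp add: bi_invariant_semigroups_def)
  have m_conv: "convolution \<Delta> (?m s) (?m t) = ?m (s + t)" if "s \<ge> 0" "t \<ge> 0" for s t
    using convolution_semigroupsD(5)[OF bi' that] that by (simp add: fun_eq_iff)
  have "Phi_bi_invariant \<Delta> \<Phi> (?m t)" if "t \<ge> 0" for t
    using inv[OF that] by (simp add: Phi_invariant_iff_bi_invariant l(3) that)
  then have m\<Phi>: "convolution \<Delta> (?m t) \<Phi> = ?m t" "convolution \<Delta> \<Phi> (?m t) = ?m t"
    if "t \<ge> 0" for t
    using that by (simp_all add: Phi_bi_invariant_def)
  \<comment> \<open>\<open>E (L\<^sub>\<mu> x)\<close> is the slice of \<open>x\<close> by \<open>\<mu> \<star> \<Phi> = \<mu>\<close>, and \<open>L\<^sub>\<mu> (E x)\<close> its slice by \<open>\<Phi> \<star> \<mu> = \<mu>\<close>.\<close>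
  have slice_V: "E_left \<Delta> (?m t) x \<in> V" if "t \<ge> 0" for t x
    using E_in_V[of "E_left \<Delta> (?m t) x"]
    by (simp only: E_left_E_left[OF m_lin[OF that] \<Phi>_linear] m\<Phi>(1)[OF that])
  have slice_E: "E_left \<Delta> (?m t) (E x) = E_left \<Delta> (?m t) x" if "t \<ge> 0" for t x
    by (simp only: E_left_E_left[OF \<Phi>_linear m_lin[OF that]] m\<Phi>(2)[OF that])
  have slice_lin: "clinear (E_left \<Delta> (?m t))" if "t \<ge> 0" for t
    by (rule clinear_E_left[of "\<lambda>x. x", OF clinear_ident m_lin[OF that]])
  have U_lin: "clinear_on V (U t)" if "t \<ge> 0" for t
  proof (rule clinear_onI)
    fix x y c assume xy: "x \<in> V"
    show "U t (c *\<^sub>C x) = c *\<^sub>C U t x"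
      by (simp only: U that xy complex_vector.subspace_scale[OF subspace_V] clinear_scale[OF slice_lin[OF that]])
    assume y: "y \<in> V"
    show "U t (x + y) = U t x + U t y"
      by (simp only: U that xy y complex_vector.subspace_add[OF subspace_V] clinear_add[OF slice_lin[OF that]])
  qed
  have U_op: "U t \<in> linear_operators V" if "t \<ge> 0" for t
  proof -
    have "U t x \<in> V" if "x \<in> V" for x
      using slice_V[OF \<open>t \<ge> 0\<close>] that \<open>t \<ge> 0\<close> by (simp only: U)
    moreover have "U t \<in> extensional V"
      by (simp add: U_def)
    ultimately show ?thesis
      using U_lin[OF that] by (auto simp: linear_operators_def PiE_def)
  qed
  have U_G: "G_invariant \<Delta> \<Phi> (U t)" if t: "t \<ge> 0" for t
    unfolding G_invariant_def
  proof
    fix x assume x: "x \<in> V"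
    have "tensor_lift V UNIV (\<lambda>a b. U t a \<otimes> b) (\<Delta> x)
      = tensor_lift_UNIV (\<lambda>a b. U t (E a) \<otimes> b) (\<Delta> x)"
      by (rule tensor_lift_coaction[OF x]) (intro clinear_intros U_lin[OF t])+
    also have "\<dots> = \<Delta> (U t x)"
      by (simp only: U[OF t E_in_V] U[OF t x] slice_E[OF t] comult_E_left[OF m_lin[OF t]])
    finally show "tensor_lift V UNIV (\<lambda>a b. U t a \<otimes> b) (\<Delta> x) = \<Delta> (U t x)" .
  qed
  have U_sg: "U (s + t) x = U s (U t x)" if st: "s \<ge> 0" "t \<ge> 0" and x: "x \<in> V" for s t x
    by (simp only: U[OF _ x] U[OF _ slice_V] st add_nonneg_nonneg
        E_left_E_left[OF m_lin[OF st(2)] m_lin[OF st(1)]] m_conv add.commute[of s t])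
  have \<epsilon>U: "\<epsilon> (U t x) = l t x" if "t \<ge> 0" "x \<in> V" for t x
    by (simp only: U[OF that] counit_E_left[OF m_lin[OF that(1)]] E_V[OF that(2)])
  have "weakly_continuous V (\<lambda>t x. \<epsilon> (U t x))"
    by (rule weakly_continuous_pullback[OF l(4), of _ "\<lambda>x. x"]) (simp_all add: \<epsilon>U)
  then have "weakly_continuous V (\<lambda>t x. \<epsilon> ((\<lambda>t\<in>{0..}. U t) t x))"
    by (rule weakly_continuous_pullback[where h = "\<lambda>x. x"]) simp_all
  then show "(\<lambda>t\<in>{0..}. \<lambda>x\<in>V. tensor_lift V UNIV (\<lambda>a b. l t a *\<^sub>C E b) (\<Delta> x))
      \<in> invariant_operator_semigroups \<Delta> \<epsilon> \<Phi>"
    unfolding U_def[symmetric] by (simp add: invariant_operator_semigroups_def U_op U_G U_sg)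
  show "t \<ge> 0 \<Longrightarrow> x \<in> V \<Longrightarrow> \<epsilon> (tensor_lift V UNIV (\<lambda>a b. l t a *\<^sub>C E b) (\<Delta> x)) = l t x"
    using \<epsilon>U[of t x] by (simp add: U_def)
qed

lemma operator_functional_correspondence:
  "one_to_one_correspondence
    (invariant_operator_semigroups \<Delta> \<epsilon> \<Phi>) (invariant_semigroups \<Delta> \<Phi>)
    (\<lambda>T. \<lambda>t\<in>{0..}. \<lambda>x\<in>V. \<epsilon> (T t x))
    (\<lambda>l. \<lambda>t\<in>{0..}. \<lambda>x\<in>V. tensor_lift V UNIV (\<lambda>a b. l t a *\<^sub>C E b) (\<Delta> x))"
proof (rule one_to_one_correspondenceI)
  fix T assume mem: "T \<in> invariant_operator_semigroups \<Delta> \<epsilon> \<Phi>"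
  then have op: "T t \<in> linear_operators V" and G: "G_invariant \<Delta> \<Phi> (T t)" if "t \<ge> 0" for t
    using that by (auto simp: invariant_operator_semigroups_def PiE_def Pi_def)
  let ?l = "\<lambda>t\<in>{0..}. \<lambda>x\<in>V. \<epsilon> (T t x)"
  have l: "?l \<in> invariant_semigroups \<Delta> \<Phi>"
    by (rule operator_to_functional_semigroup[OF mem])
  have "(\<lambda>x\<in>V. tensor_lift V UNIV (\<lambda>a b. ?l t a *\<^sub>C E b) (\<Delta> x)) = T t" if t: "t \<ge> 0" for t
  proof (rule extensionalityI[of _ V])
    show "T t \<in> extensional V"
      using op[OF t] by (simp add: linear_operators_def PiE_def)
    fix x assume x: "x \<in> V"
    have "clinear_on V (?l t)" "Phi_invariant \<Delta> \<Phi> (?l t)"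
      using l t convolution_semigroupsD(3)[of ?l V "convolution_left \<Delta> \<Phi>" t]
      unfolding invariant_semigroups_def by blast+
    then have "tensor_lift V UNIV (\<lambda>a b. ?l t a *\<^sub>C E b) (\<Delta> x) = E_left \<Delta> (\<lambda>x. ?l t (E x)) x"
      by (rule operator_of_functional[OF _ _ x])
    also have "\<dots> = T t x"
      using G_invariant_eq_slice[OF op[OF t] G[OF t] x] t by simp
    finally show "(\<lambda>x\<in>V. tensor_lift V UNIV (\<lambda>a b. ?l t a *\<^sub>C E b) (\<Delta> x)) x = T t x"
      using x by simp
  qed simp
  moreover have "T \<in> extensional {0..}"
    using mem by (simp add: invariant_operator_semigroups_def PiE_def)
  ultimately show "(\<lambda>t\<in>{0..}. \<lambda>x\<in>V. tensor_lift V UNIV (\<lambda>a b. ?l t a *\<^sub>C E b) (\<Delta> x)) = T"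
    by (intro extensionalityI[of _ "{0..}"]) auto
next
  fix l assume mem: "l \<in> invariant_semigroups \<Delta> \<Phi>"
  then have "l \<in> convolution_semigroups V (convolution_left \<Delta> \<Phi>)"
    by (simp add: invariant_semigroups_def)
  note l = convolution_semigroupsD(1,2)[OF this]
  let ?T = "\<lambda>t\<in>{0..}. \<lambda>x\<in>V. tensor_lift V UNIV (\<lambda>a b. l t a *\<^sub>C E b) (\<Delta> x)"
  have "(\<lambda>x\<in>V. \<epsilon> (?T t x)) = l t" if t: "t \<ge> 0" for t
    by (rule extensionalityI[of _ V]) (simp_all add: l t functional_to_operator_semigroup(2)[OF mem])
  then show "(\<lambda>t\<in>{0..}. \<lambda>x\<in>V. \<epsilon> (?T t x)) = l"
    by (intro extensionalityI[of _ "{0..}"]) (simp_all add: l)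
qed (fact operator_to_functional_semigroup functional_to_operator_semigroup(1))+

end

theorem theorem6p1:
  fixes star :: "'a::complex_algebra_1 \<Rightarrow> 'a"
    and \<Delta> :: "'a \<Rightarrow> ('a, 'a) tensor"
    and \<epsilon> :: "'a \<Rightarrow> complex"
    and antipode :: "'a \<Rightarrow> 'a"
    and \<Phi> :: "'a \<Rightarrow> complex"
  assumes "cqg_algebra star \<Delta> \<epsilon> antipode"
    and "idempotent_state star \<Delta> \<Phi>"
  shows
    "one_to_one_correspondence
      (invariant_operator_semigroups \<Delta> \<epsilon> \<Phi>) (invariant_semigroups \<Delta> \<Phi>)
      (\<lambda>T. \<lambda>t\<in>{0..}. \<lambda>x\<in>O_left \<Delta> \<Phi>. \<epsilon> (T t x))
      (\<lambda>l. \<lambda>t\<in>{0..}. \<lambda>x\<in>O_left \<Delta> \<Phi>.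
        tensor_lift (O_left \<Delta> \<Phi>) UNIV (\<lambda>a b. l t a *\<^sub>C E_left \<Delta> \<Phi> b) (\<Delta> x))
    \<and> one_to_one_correspondence
      (invariant_semigroups \<Delta> \<Phi>) (bi_invariant_semigroups \<Delta> \<Phi>)
      (\<lambda>l. \<lambda>t\<in>{0..}. \<lambda>x. l t (E_left \<Delta> \<Phi> x))
      (\<lambda>\<mu>. \<lambda>t\<in>{0..}. restrict (\<mu> t) (O_left \<Delta> \<Phi>))
    \<and> one_to_one_correspondence
      (bi_invariant_semigroups \<Delta> \<Phi>) (double_coset_semigroups \<Delta> \<Phi>)
      (\<lambda>\<mu>. \<lambda>t\<in>{0..}. restrict (\<mu> t) (O_bi \<Delta> \<Phi>))
      (\<lambda>f. \<lambda>t\<in>{0..}. \<lambda>x. f t (E_left \<Delta> \<Phi> (E_right \<Delta> \<Phi> x)))"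
proof -
  interpret cqg_algebra star \<Delta> \<epsilon> antipode
    by (rule assms(1))
  interpret coalgebra_idempotent \<Delta> \<epsilon> \<Phi>
    using assms(2)
    by unfold_locales
      (simp_all add: comult_linear comult_coassoc counit_linear counit_left counit_right idempotent_state_def)
  show ?thesis
    by (intro conjI operator_functional_correspondence invariant_bi_invariant_correspondence
        bi_invariant_double_coset_correspondence)
qed

end
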